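(* Let $\epsilon_n=(n/\log n)^{-\alpha^{*}/(2\alpha^{*}+d)}$, let $R>0$ and let $M>0$ be a constant. Let $\boldsymbol{\alpha}\in\mathbb{A}$ and $f_0\in\mathcal{B}^{\boldsymbol{\alpha}}_{\infty,\infty}(R)$. In the Gaussian regression model with fixed design and known variance $\sigma_0^2$ described in the context, consider testing $H_0:f=f_0$ against $H_1:f\in\{f\in\mathcal{B}^{\boldsymbol{\alpha}}_{\infty,\infty}(R):\|f-f_0\|_\infty>M\epsilon_n\}$. Let $\phi_n$ be any ($\{0,1\}$-valued, measurable in the observations, possibly depending on $f_0$) test for this problem such that $\mathrm{E}_0\phi_n\to0$. Then there exists a constant $Q>0$ such that $$\sup_{f\in\mathcal{B}^{\boldsymbol{\alpha}}_{\infty,\infty}(R):\ \|f-f_0\|_\infty>M\epsilon_n}\mathrm{E}_f(1-\phi_n)\gtrsim n^{-Q},$$ i.e. the left-hand side is at least $c\,n^{-Q}$ for some constant $c>0$ and all sufficiently large $n$.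
   Context: Model. $Y_i=f(\boldsymbol{X}_i)+\varepsilon_i$, $i=1,\dots,n$, with $\varepsilon_i$ i.i.d. $\mathrm{N}(0,\sigma_0^2)$, $\sigma_0>0$ known. The design points $\boldsymbol{X}_i\in[0,1]^d$ are fixed with $\sup_{\boldsymbol{x}\in[0,1]^d}|G_n(\boldsymbol{x})-U(\boldsymbol{x})|=O(1/n)$, where $G_n$ is the empirical distribution function of $\boldsymbol{X}_1,\dots,\boldsymbol{X}_n$ and $U$ the distribution function of the uniform distribution on $[0,1]^d$. $\mathrm{E}_f$ denotes expectation when the regression function is $f$, and $\mathrm{E}_0=\mathrm{E}_{f_0}$. Wavelets. In each coordinate $l=1,\dots,d$ take the Cohen–Daubechies–Vial (CDV) boundary-corrected compactly supported orthonormal wavelet basis of $L_2([0,1])$ of regularity $\eta$ (so that derivatives of order $r<\eta+1$ of all generators are uniformly bounded), started at a fixed positive integer level $N_l$ with $2^{N_l}\ge2\eta$: father wavelets $\varphi_{N_l,m_l}(x)=2^{N_l/2}\varphi_{m_l}(2^{N_l}x)$, $0\le m_l\le2^{N_l}-1$, and mother wavelets $\psi_{j_l,k_l}(x)=2^{j_l/2}\psi_{k_l}(2^{j_l}x)$, $j_l\ge N_l$, $0\le k_l\le2^{j_l}-1$; interior generators are integer translates of a Daubechies pair, boundary ones are fixed linear combinations of these. Tensor products: $\varphi_{\boldsymbol{N},\boldsymbol{m}}(\boldsymbol{x})=\prod_l\varphi_{N_l,m_l}(x_l)$, $\psi_{\boldsymbol{j},\boldsymbol{k}}(\boldsymbol{x})=\prod_l\psi_{j_l,k_l}(x_l)$.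 Convention: the family $\psi_{\boldsymbol{j},\boldsymbol{k}}$ is understood to include also the mixed products in which some (but not all) factors $\psi_{j_l,k_l}$ are replaced by father wavelets $\varphi_{N_l,k_l}$ (then $j_l=N_l$), the identifying index being suppressed; together with the $\varphi_{\boldsymbol{N},\boldsymbol{m}}$ they form an orthonormal basis of $L_2([0,1]^d)$. Besov balls. For $\boldsymbol{\alpha}$ with $0<\alpha_l<\eta+1$, $\alpha^*$ is the harmonic mean, $(\alpha^* )^{-1}=d^{-1}\sum_{l=1}^d\alpha_l^{-1}$, and $$\|f\|_{\mathcal{B}^{\boldsymbol{\alpha}}_{\infty,\infty}}=\max_{\boldsymbol{m}}|\langle f,\varphi_{\boldsymbol{N},\boldsymbol{m}}\rangle|+\sup_{\boldsymbol{j}}2^{\sum_{l=1}^d\alpha_lj_l\left(\frac1d+\frac1{2\alpha^*}\right)}\max_{\boldsymbol{k}}|\langle f,\psi_{\boldsymbol{j},\boldsymbol{k}}\rangle|;$$ $\mathcal{B}^{\boldsymbol{\alpha}}_{\infty,\infty}(R)$ is the set of uniformly continuous $f$ on $[0,1]^d$ with $\|f\|_{\mathcal{B}^{\boldsymbol{\alpha}}_{\infty,\infty}}\le R$. The range of smoothness is $\mathbb{A}=\{\boldsymbol{\alpha}\in(0,\infty)^d:\ 2\alpha^*d/(2\alpha^*+d)<\alpha_l<\eta+1,\ l=1,\dots,d\}$.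
   Formalization: The formal theorem additionally assumes that the father-wavelet part of the Besov norm of f_0, max_m |<f_0, φ_{N,m}>|, is strictly less than R; if it equals R the claim is false, since exponentially consistent tests exist (e.g. d=1, f_0=Rφ_{N,m}). *)

theory Defs
  imports "HOL-Probability.Probability" "HOL-Library.Landau_Symbols"
begin

section \<open>Cohen--Daubechies--Vial wavelets on the unit interval\<close>

text \<open>
  A Daubechies pair with \<open>p\<close> vanishing moments: orthonormal filter \<open>h\<close> of minimal length \<open>2 p\<close>,
  centred so that \<open>\<phi>\<close> and \<open>\<psi>\<close> are supported in \<open>[1 - p, p]\<close>. Every choice of phase
  (extremal phase, least asymmetric, ...) is covered.
\<close>

definition daubechies_filter :: "nat \<Rightarrow> (int \<Rightarrow> real) \<Rightarrow> bool" where
  "daubechies_filter p h \<longleftrightarrow>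
     1 \<le> p \<and>
     (\<forall>k. k \<notin> {1 - int p..int p} \<longrightarrow> h k = 0) \<and>
     (\<Sum>k\<in>{1 - int p..int p}. h k) = sqrt 2 \<and>
     (\<forall>m. (\<Sum>k\<in>{1 - int p..int p}. h k * h (k + 2 * m)) = (if m = 0 then 1 else 0)) \<and>
     (\<forall>r<p. (\<Sum>k\<in>{1 - int p..int p}. (- 1) powi k * real_of_int k ^ r * h k) = 0)"

definition daubechies_pair ::
  "nat \<Rightarrow> (int \<Rightarrow> real) \<Rightarrow> (real \<Rightarrow> real) \<Rightarrow> (real \<Rightarrow> real) \<Rightarrow> bool" where
  "daubechies_pair p h \<phi> \<psi> \<longleftrightarrow>
     daubechies_filter p h \<and>
     (\<forall>x. x \<notin> {1 - real p..real p} \<longrightarrow> \<phi> x = 0) \<and>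
     (\<forall>x. \<phi> x = sqrt 2 * (\<Sum>k\<in>{1 - int p..int p}. h k * \<phi> (2 * x - real_of_int k))) \<and>
     integrable lborel \<phi> \<and> (LBINT x. \<phi> x) = 1 \<and>
     (\<forall>m::int. (LBINT x. \<phi> x * \<phi> (x - real_of_int m)) = (if m = 0 then 1 else 0)) \<and>
     (\<forall>x. \<psi> x = sqrt 2 *
        (\<Sum>k\<in>{1 - int p..int p}. (- 1) powi k * h (1 - k) * \<phi> (2 * x - real_of_int k)))"

text \<open>\<open>u\<close> is an \<open>L\<^sub>2\<close>-orthonormal basis of the span of \<open>v 0, ..., v (p - 1)\<close>.\<close>

definition orthonormalizes :: "nat \<Rightarrow> (nat \<Rightarrow> real \<Rightarrow> real) \<Rightarrow> (nat \<Rightarrow> real \<Rightarrow> real) \<Rightarrow> bool" where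
  "orthonormalizes p v u \<longleftrightarrow>
     (\<exists>c. \<forall>k<p. \<forall>x. u k x = (\<Sum>i<p. c k i * v i x)) \<and>
     (\<forall>i<p. \<forall>k<p. (LBINT x. u i x * u k x) = (if i = k then 1 else 0))"

text \<open>
  Edge functions of Cohen, Daubechies and Vial on the half-line \<open>[0, \<infinity>)\<close>, before
  orthonormalization. Together with the interior translates \<open>\<phi> (x - m)\<close>, \<open>m \<ge> p\<close>, the father edge
  functions reproduce the polynomials of degree less than \<open>p\<close>. The mother edge functions are the
  once dilated father edge functions minus their projections onto the undilated ones.
\<close>

definition edge_father :: "nat \<Rightarrow> (real \<Rightarrow> real) \<Rightarrow> nat \<Rightarrow> real \<Rightarrow> real" where
  "edge_father p \<phi> k x =
     (if 0 \<le> x then \<Sum>n=k..2 * p - 2. real (n choose k) * \<phi> (x + real n - real p + 1) else 0)"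

definition edge_mother :: "nat \<Rightarrow> (nat \<Rightarrow> real \<Rightarrow> real) \<Rightarrow> nat \<Rightarrow> real \<Rightarrow> real" where
  "edge_mother p u k x =
     sqrt 2 * u k (2 * x) - (\<Sum>i<p. (LBINT y. sqrt 2 * u k (2 * y) * u i y) * u i x)"

record cdv =
  moments :: nat
  filt :: "int \<Rightarrow> real"
  father :: "real \<Rightarrow> real"
  mother :: "real \<Rightarrow> real"
  left_father :: "nat \<Rightarrow> real \<Rightarrow> real"
  left_mother :: "nat \<Rightarrow> real \<Rightarrow> real"
  right_father :: "nat \<Rightarrow> real \<Rightarrow> real"
  right_mother :: "nat \<Rightarrow> real \<Rightarrow> real"

text \<open>
  The right edge is the mirror image of the left one: its generators are functions on \<open>[0, \<infinity>)\<close>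
  of the (scaled) distance to the right end point, built from the reflected father \<open>\<phi> (1 - x)\<close>.
\<close>

definition cdv_generators :: "cdv \<Rightarrow> bool" where
  "cdv_generators W \<longleftrightarrow>
     daubechies_pair (moments W) (filt W) (father W) (mother W) \<and>
     orthonormalizes (moments W) (edge_father (moments W) (father W)) (left_father W) \<and>
     orthonormalizes (moments W) (edge_mother (moments W) (left_father W)) (left_mother W) \<and>
     orthonormalizes (moments W) (edge_father (moments W) (\<lambda>x. father W (1 - x))) (right_father W) \<and>
     orthonormalizes (moments W) (edge_mother (moments W) (right_father W)) (right_mother W)"

definition phi :: "cdv \<Rightarrow> nat \<Rightarrow> nat \<Rightarrow> real \<Rightarrow> real" where
  "phi W j k x = 2 powr (real j / 2) *
     (if k < moments W then left_father W k (2 ^ j * x)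
      else if k < 2 ^ j - moments W then father W (2 ^ j * x - real k)
      else right_father W (2 ^ j - 1 - k) (2 ^ j * (1 - x)))"

definition psi :: "cdv \<Rightarrow> nat \<Rightarrow> nat \<Rightarrow> real \<Rightarrow> real" where
  "psi W j k x = 2 powr (real j / 2) *
     (if k < moments W then left_mother W k (2 ^ j * x)
      else if k < 2 ^ j - moments W then mother W (2 ^ j * x - real k)
      else right_mother W (2 ^ j - 1 - k) (2 ^ j * (1 - x)))"

definition inner01 :: "(real \<Rightarrow> real) \<Rightarrow> (real \<Rightarrow> real) \<Rightarrow> real" where
  "inner01 f g = (LBINT x:{0..1}. f x * g x)"

definition orthonormal_basis01 :: "cdv \<Rightarrow> nat \<Rightarrow> bool" where
  "orthonormal_basis01 W J \<longleftrightarrow>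
     (\<forall>m<2^J. \<forall>m'<2^J. inner01 (phi W J m) (phi W J m') = (if m = m' then 1 else 0)) \<and>
     (\<forall>m<2^J. \<forall>j\<ge>J. \<forall>k<2^j. inner01 (phi W J m) (psi W j k) = 0) \<and>
     (\<forall>j\<ge>J. \<forall>k<2^j. \<forall>j'\<ge>J. \<forall>k'<2^j'.
        inner01 (psi W j k) (psi W j' k') = (if j = j' \<and> k = k' then 1 else 0)) \<and>
     (\<forall>f. f \<in> borel_measurable lborel \<and> set_integrable lborel {0..1} (\<lambda>x. (f x)\<^sup>2) \<and>
        (\<forall>m<2^J. inner01 f (phi W J m) = 0) \<and>
        (\<forall>j\<ge>J. \<forall>k<2^j. inner01 f (psi W j k) = 0)
        \<longrightarrow> (AE x in lborel. x \<in> {0..1} \<longrightarrow> f x = 0))"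

text \<open>
  Regularity \<open>\<eta>\<close>: derivatives of all orders \<open>r < \<eta> + 1\<close> exist and are bounded. It suffices to
  say so for \<open>\<phi>\<close>, of which all other generators are finite linear combinations after dilation and
  translation (and, at the edges, restriction). Since \<open>\<phi>\<close> with \<open>p\<close> vanishing moments is much less
  regular than \<open>p\<close>, the number of moments is not identified with \<open>\<eta>\<close>; the two edges are
  separated on all levels from \<open>J\<close> onwards if \<open>2 ^ J \<ge> 2 p\<close>. For the present construction the
  final conjunct is the theorem of Cohen, Daubechies and Vial.
\<close>

definition cdv_basis :: "real \<Rightarrow> nat \<Rightarrow> cdv \<Rightarrow> bool" where
  "cdv_basis \<eta> J W \<longleftrightarrow>
     cdv_generators W \<and>
     (\<forall>r::nat. real r < \<eta> \<longrightarrow> (\<forall>x. (deriv ^^ r) (father W) field_differentiable (at x))) \<and>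
     (\<forall>r::nat. real r < \<eta> + 1 \<longrightarrow> bounded (range ((deriv ^^ r) (father W)))) \<and>
     0 < J \<and> 2 * \<eta> \<le> 2 ^ J \<and> 2 * moments W \<le> 2 ^ J \<and>
     orthonormal_basis01 W J"

section \<open>Tensor products and anisotropic Besov balls\<close>

definition unit_cube :: "(real ^ 'd::finite) set" where
  "unit_cube = {x. \<forall>l. 0 \<le> x $ l \<and> x $ l \<le> 1}"

definition cube_inner :: "(real ^ 'd::finite \<Rightarrow> real) \<Rightarrow> (real ^ 'd \<Rightarrow> real) \<Rightarrow> real" where
  "cube_inner f g = (LINT x:unit_cube|lborel. f x * g x)"

definition positions :: "('d::finite \<Rightarrow> nat) \<Rightarrow> ('d \<Rightarrow> nat) set" where
  "positions j = {k. \<forall>l. k l < 2 ^ j l}"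

definition tensor_phi ::
  "cdv \<Rightarrow> ('d::finite \<Rightarrow> nat) \<Rightarrow> ('d \<Rightarrow> nat) \<Rightarrow> real ^ 'd \<Rightarrow> real" where
  "tensor_phi W N m x = (\<Prod>l\<in>UNIV. phi W (N l) (m l) (x $ l))"

text \<open>
  The set \<open>S\<close> of coordinates carrying a mother factor is the index that is usually suppressed;
  \<open>S = UNIV\<close> gives the pure mother products, other nonempty \<open>S\<close> the mixed ones.
\<close>

definition tensor_psi ::
  "cdv \<Rightarrow> 'd set \<Rightarrow> ('d::finite \<Rightarrow> nat) \<Rightarrow> ('d \<Rightarrow> nat) \<Rightarrow> real ^ 'd \<Rightarrow> real" where
  "tensor_psi W S j k x =
     (\<Prod>l\<in>UNIV. if l \<in> S then psi W (j l) (k l) (x $ l) else phi W (j l) (k l) (x $ l))"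

definition levels :: "('d::finite \<Rightarrow> nat) \<Rightarrow> ('d set \<times> ('d \<Rightarrow> nat)) set" where
  "levels N = {(S, j). S \<noteq> {} \<and> (\<forall>l. N l \<le> j l) \<and> (\<forall>l. l \<notin> S \<longrightarrow> j l = N l)}"

definition harmonic_mean :: "real ^ 'd::finite \<Rightarrow> real" where
  "harmonic_mean \<alpha> = inverse ((\<Sum>l\<in>UNIV. inverse (\<alpha> $ l)) / real CARD('d))"

text \<open>
  On the sphere \<open>father_norm W N f = R\<close> the ball of radius \<open>R\<close> is degenerate at \<open>f\<close>: membership
  forces all mother coefficients of \<open>f\<close> to vanish, and mother coefficients can be added only at the
  price of shrinking father coefficients by a comparable amount. Near such an \<open>f\<close> the ball is
  essentially finite-dimensional, and exponentially consistent tests exist.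
\<close>

definition father_norm ::
  "cdv \<Rightarrow> ('d::finite \<Rightarrow> nat) \<Rightarrow> (real ^ 'd \<Rightarrow> real) \<Rightarrow> real" where
  "father_norm W N f = (MAX m\<in>positions N. \<bar>cube_inner f (tensor_phi W N m)\<bar>)"

definition besov_norm ::
  "cdv \<Rightarrow> ('d::finite \<Rightarrow> nat) \<Rightarrow> real ^ 'd \<Rightarrow> (real ^ 'd \<Rightarrow> real) \<Rightarrow> ereal" where
  "besov_norm W N \<alpha> f =
     ereal (father_norm W N f) +
     (SUP (S, j)\<in>levels N. ereal (
        2 powr (\<Sum>l\<in>UNIV. \<alpha> $ l * real (j l) *
                  (1 / real CARD('d) + 1 / (2 * harmonic_mean \<alpha>))) *
        (MAX k\<in>positions j. \<bar>cube_inner f (tensor_psi W S j k)\<bar>)))"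

definition besov_ball ::
  "cdv \<Rightarrow> ('d::finite \<Rightarrow> nat) \<Rightarrow> real ^ 'd \<Rightarrow> real \<Rightarrow> (real ^ 'd \<Rightarrow> real) set" where
  "besov_ball W N \<alpha> R =
     {f. uniformly_continuous_on unit_cube f \<and> besov_norm W N \<alpha> f \<le> ereal R}"

definition smoothness_range :: "real \<Rightarrow> (real ^ 'd::finite) set" where
  "smoothness_range \<eta> = {\<alpha>. \<forall>l. 0 < \<alpha> $ l \<and>
     2 * harmonic_mean \<alpha> * real CARD('d) / (2 * harmonic_mean \<alpha> + real CARD('d)) < \<alpha> $ l \<and>
     \<alpha> $ l < \<eta> + 1}"

definition sup_dist :: "(real ^ 'd::finite \<Rightarrow> real) \<Rightarrow> (real ^ 'd \<Rightarrow> real) \<Rightarrow> real" where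
  "sup_dist f g = (SUP x\<in>unit_cube. \<bar>f x - g x\<bar>)"

section \<open>The fixed design regression model\<close>

text \<open>
  The design is a triangular array: \<open>X n 1, ..., X n n\<close> are the design points of sample size \<open>n\<close>.
  (The initial segments of one infinite sequence never have discrepancy \<open>O(1 / n)\<close>.)
\<close>

definition empirical_cdf :: "(nat \<Rightarrow> nat \<Rightarrow> real ^ 'd::finite) \<Rightarrow> nat \<Rightarrow> real ^ 'd \<Rightarrow> real" where
  "empirical_cdf X n x = real (card {i \<in> {1..n}. \<forall>l. X n i $ l \<le> x $ l}) / real n"

definition uniform_cdf :: "real ^ 'd::finite \<Rightarrow> real" where
  "uniform_cdf x = (\<Prod>l\<in>UNIV. x $ l)"

definition uniform_design :: "(nat \<Rightarrow> nat \<Rightarrow> real ^ 'd::finite) \<Rightarrow> bool" where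
  "uniform_design X \<longleftrightarrow>
     (\<forall>n. \<forall>i\<in>{1..n}. X n i \<in> unit_cube) \<and>
     (\<lambda>n. SUP x\<in>unit_cube. \<bar>empirical_cdf X n x - uniform_cdf x\<bar>) \<in> O(\<lambda>n. 1 / real n)"

definition noise :: "real \<Rightarrow> nat \<Rightarrow> (nat \<Rightarrow> real) measure" where
  "noise \<sigma> n = (\<Pi>\<^sub>M i\<in>{1..n}. density lborel (normal_density 0 \<sigma>))"

definition expect ::
  "real \<Rightarrow> (nat \<Rightarrow> nat \<Rightarrow> real ^ 'd::finite) \<Rightarrow> nat \<Rightarrow> (real ^ 'd \<Rightarrow> real) \<Rightarrow>
   ((nat \<Rightarrow> real) \<Rightarrow> real) \<Rightarrow> real" where
  "expect \<sigma> X n f T = (LINT \<epsilon>|noise \<sigma> n. T (\<lambda>i\<in>{1..n}. f (X n i) + \<epsilon> i))"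

definition is_test :: "nat \<Rightarrow> ((nat \<Rightarrow> real) \<Rightarrow> real) \<Rightarrow> bool" where
  "is_test n T \<longleftrightarrow>
     T \<in> borel_measurable (\<Pi>\<^sub>M i\<in>{1..n}. borel) \<and>
     (\<forall>y\<in>space (\<Pi>\<^sub>M i\<in>{1..n}. (borel :: real measure)). T y \<in> {0, 1})"

definition rate :: "real ^ 'd::finite \<Rightarrow> nat \<Rightarrow> real" where
  "rate \<alpha> n = (real n / ln (real n)) powr
     (- harmonic_mean \<alpha> / (2 * harmonic_mean \<alpha> + real CARD('d)))"

end

theory Submission
  imports Defs "HOL-Real_Asymp.Real_Asymp"
begin

text \<open>
  Two hypotheses cannot be told apart better than their likelihood ratio permits. If \<open>f\<close> differs from
  \<open>f\<^sub>0\<close> by \<open>\<theta> i\<close> at the design points, a test of small level at \<open>f\<^sub>0\<close> accepts under \<open>f\<close> with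
  probability at least a constant times \<open>exp (- (\<Sum>i. (\<theta> i)\<^sup>2) / \<sigma>\<^sub>0\<^sup>2)\<close>. It therefore suffices to find,
  for large \<open>n\<close>, an alternative \<open>f\<close> in the ball, farther than \<open>M * rate \<alpha> n\<close> from \<open>f\<^sub>0\<close> in sup norm, for
  which this sum of squares is of order \<open>ln n\<close>.

  The alternative is \<open>f\<^sub>0\<close> plus a multiple of a single tensor wavelet. Since the basis is orthonormal,
  this changes one coefficient of \<open>f\<^sub>0\<close>. The father coefficients leave some room in the ball, and with
  the right sign of the perturbation all of it can be used
  (\<open>besov_ball_add_wavelet\<close>). The levels are chosen inversely proportional to the smoothness,
  \<open>\<alpha> $ l * j l \<approx> t\<close>. With \<open>\<delta> = 2 powr (- t)\<close>, with \<open>h\<close> the harmonic mean and \<open>d\<close> the dimension, the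
  largest admissible amplitude is of order \<open>\<delta> powr (1 + d / (2 * h))\<close>, while the wavelet has
  height of order \<open>\<delta> powr (- d / (2 * h))\<close> and lives on a box of volume of order \<open>\<delta> powr (d / h)\<close>. So
  the perturbation has height of order \<open>\<delta>\<close>, and a uniform design sees it with a sum of squares of
  order \<open>n * \<delta> powr (2 + d / h)\<close> (\<open>besov_ball_bump\<close>). For \<open>\<delta>\<close> a multiple of the rate, the latter is of
  order \<open>ln n\<close> (\<open>rate_powr\<close>); the multiple is chosen to beat \<open>M\<close>, and it only affects the exponent \<open>Q\<close>.

  The wavelet is taken at the interior position nearest to the origin. Its support lies in a box
  with a corner at the origin, so the number of design points in it is controlled by one value of the
  empirical distribution function.

  The bound on the acceptance probability (\<open>expect_ge_two_point\<close>) comes from comparing \<open>f\<close> with its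
  mirror image \<open>2 f\<^sub>0 - f\<close>: the densities \<open>p\<close>, \<open>p'\<close> and \<open>p\<^sub>0\<close> belonging to
  \<open>f\<close>, its mirror image and \<open>f\<^sub>0\<close> satisfy \<open>exp a * p + p' \<ge> 2 * p\<^sub>0\<close>, with \<open>a\<close> the
  sum of squares above divided by \<open>\<sigma>\<^sub>0\<^sup>2\<close>, which is the arithmetic-geometric mean inequality.
\<close>

section \<open>Testing two Gaussian shifts\<close>

lemma distr_PiM_coordinatewise:
  assumes "finite I" and M: "\<And>i. prob_space (M i)"
    and f [measurable]: "\<And>i. f i \<in> measurable (M i) (N i)"
  shows "distr (PiM I M) (PiM I N) (\<lambda>x. \<lambda>i\<in>I. f i (x i)) = PiM I (\<lambda>i. distr (M i) (N i) (f i))"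
proof -
  interpret M: product_prob_space M
    by (intro product_prob_spaceI M)
  interpret D: product_prob_space "\<lambda>i. distr (M i) (N i) (f i)"
    by (intro product_prob_spaceI prob_space.prob_space_distr M f)
  show ?thesis
  proof (rule D.PiM_eqI)
    fix A assume A: "\<And>i. i \<in> I \<Longrightarrow> A i \<in> sets (distr (M i) (N i) (f i))"
    have pre: "(\<lambda>x. \<lambda>i\<in>I. f i (x i)) -` Pi\<^sub>E I A \<inter> space (PiM I M) =
        (\<Pi>\<^sub>E i\<in>I. f i -` A i \<inter> space (M i))"
      by (auto simp: space_PiM PiE_iff extensional_def)
    have "emeasure (distr (PiM I M) (PiM I N) (\<lambda>x. \<lambda>i\<in>I. f i (x i))) (Pi\<^sub>E I A) =
        emeasure (PiM I M) (\<Pi>\<^sub>E i\<in>I. f i -` A i \<inter> space (M i))"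
      using A \<open>finite I\<close> by (subst emeasure_distr) (auto simp: pre intro!: sets_PiM_I_finite)
    also have "\<dots> = (\<Prod>i\<in>I. emeasure (M i) (f i -` A i \<inter> space (M i)))"
      using A \<open>finite I\<close> by (intro M.emeasure_PiM measurable_sets[OF f]) auto
    also have "\<dots> = (\<Prod>i\<in>I. emeasure (distr (M i) (N i) (f i)) (A i))"
      using A by (intro prod.cong refl) (simp add: emeasure_distr)
    finally show "emeasure (distr (PiM I M) (PiM I N) (\<lambda>x. \<lambda>i\<in>I. f i (x i))) (Pi\<^sub>E I A) =
        (\<Prod>i\<in>I. emeasure (distr (M i) (N i) (f i)) (A i))" .
  qed (use \<open>finite I\<close> in \<open>auto intro!: sets_PiM_cong\<close>)
qed

lemma PiM_density:
  fixes f :: "'i \<Rightarrow> 'a \<Rightarrow> ennreal"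
  assumes "finite I" and M: "\<And>i. sigma_finite_measure (M i)"
    and D: "\<And>i. sigma_finite_measure (density (M i) (f i))"
    and f [measurable]: "\<And>i. f i \<in> borel_measurable (M i)"
  shows "PiM I (\<lambda>i. density (M i) (f i)) = density (PiM I M) (\<lambda>x. \<Prod>i\<in>I. f i (x i))"
proof -
  interpret M: product_sigma_finite M
    by (simp add: product_sigma_finite_def M)
  interpret D: product_sigma_finite "\<lambda>i. density (M i) (f i)"
    by (simp add: product_sigma_finite_def D)
  have "density (PiM I M) (\<lambda>x. \<Prod>i\<in>I. f i (x i)) = PiM I (\<lambda>i. density (M i) (f i))"
  proof (rule D.PiM_eqI)
    fix A assume "\<And>i. i \<in> I \<Longrightarrow> A i \<in> sets (density (M i) (f i))"
    then have A [measurable]: "i \<in> I \<Longrightarrow> A i \<in> sets (M i)" for i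
      by simp
    have box: "Pi\<^sub>E I A \<in> sets (PiM I M)"
      using A \<open>finite I\<close> by (auto intro!: sets_PiM_I_finite)
    have "emeasure (density (PiM I M) (\<lambda>x. \<Prod>i\<in>I. f i (x i))) (Pi\<^sub>E I A) =
        (\<integral>\<^sup>+x. (\<Prod>i\<in>I. f i (x i)) * indicator (Pi\<^sub>E I A) x \<partial>PiM I M)"
      using box by (subst emeasure_density) (auto)
    also have "\<dots> = (\<integral>\<^sup>+x. (\<Prod>i\<in>I. f i (x i) * indicator (A i) (x i)) \<partial>PiM I M)"
    proof (rule nn_integral_cong)
      fix x assume "x \<in> space (PiM I M)"
      then have ext: "x \<in> extensional I"
        by (auto simp: space_PiM PiE_def)
      show "(\<Prod>i\<in>I. f i (x i)) * indicator (Pi\<^sub>E I A) x = (\<Prod>i\<in>I. f i (x i) * indicator (A i) (x i))"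
      proof (cases "\<forall>i\<in>I. x i \<in> A i")
        case True
        with ext show ?thesis by (auto simp: PiE_def Pi_def indicator_def intro!: prod.cong)
      next
        case False
        then obtain i where "i \<in> I" "x i \<notin> A i" by auto
        moreover from this have "x \<notin> Pi\<^sub>E I A" by auto
        moreover have "(\<Prod>i\<in>I. f i (x i) * indicator (A i) (x i)) = 0"
          using \<open>i \<in> I\<close> \<open>x i \<notin> A i\<close> \<open>finite I\<close> by (intro prod_zero bexI[of _ i]) auto
        ultimately show ?thesis by simp
      qed
    qed
    also have "\<dots> = (\<Prod>i\<in>I. \<integral>\<^sup>+x. f i x * indicator (A i) x \<partial>M i)"
      using \<open>finite I\<close> by (intro M.product_nn_integral_prod) auto
    also have "\<dots> = (\<Prod>i\<in>I. emeasure (density (M i) (f i)) (A i))"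
      by (intro prod.cong refl) (simp add: emeasure_density)
    finally show "emeasure (density (PiM I M) (\<lambda>x. \<Prod>i\<in>I. f i (x i))) (Pi\<^sub>E I A) =
        (\<Prod>i\<in>I. emeasure (density (M i) (f i)) (A i))" .
  qed (use \<open>finite I\<close> in \<open>auto intro!: sets_PiM_cong\<close>)
  then show ?thesis ..
qed

lemma distr_normal_density_shift:
  assumes "\<sigma> > 0"
  shows "distr (density lborel (normal_density 0 \<sigma>)) borel (\<lambda>x. m + x) =
    density lborel (normal_density m \<sigma>)"
proof -
  have "density lborel (normal_density m \<sigma>) =
      density (distr lborel borel ((+) m)) (normal_density m \<sigma>)"
    by (simp add: lborel_distr_plus)
  also have "\<dots> = distr (density lborel (\<lambda>x. normal_density m \<sigma> (m + x))) borel ((+) m)"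
    by (subst density_distr) auto
  also have "(\<lambda>x. normal_density m \<sigma> (m + x)) = normal_density 0 \<sigma>"
    by (auto simp: normal_density_def)
  finally show ?thesis by simp
qed

definition gauss_density :: "real \<Rightarrow> nat \<Rightarrow> (nat \<Rightarrow> real) \<Rightarrow> (nat \<Rightarrow> real) \<Rightarrow> real" where
  "gauss_density \<sigma> n \<mu> y = (\<Prod>i\<in>{1..n}. normal_density (\<mu> i) \<sigma> (y i))"

lemma gauss_density_nonneg: "0 \<le> gauss_density \<sigma> n \<mu> y"
  by (auto simp: gauss_density_def intro!: prod_nonneg)

lemma distr_noise_shift:
  assumes "\<sigma> > 0"
  shows "distr (noise \<sigma> n) (\<Pi>\<^sub>M i\<in>{1..n}. borel) (\<lambda>\<epsilon>. \<lambda>i\<in>{1..n}. \<mu> i + \<epsilon> i) =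
    density (\<Pi>\<^sub>M i\<in>{1..n}. lborel) (gauss_density \<sigma> n \<mu>)"
proof -
  have "distr (noise \<sigma> n) (\<Pi>\<^sub>M i\<in>{1..n}. borel) (\<lambda>\<epsilon>. \<lambda>i\<in>{1..n}. \<mu> i + \<epsilon> i) =
      (\<Pi>\<^sub>M i\<in>{1..n}. distr (density lborel (normal_density 0 \<sigma>)) borel (\<lambda>x. \<mu> i + x))"
    unfolding noise_def
    by (rule distr_PiM_coordinatewise) (auto intro!: prob_space_normal_density assms)
  also have "\<dots> = (\<Pi>\<^sub>M i\<in>{1..n}. density lborel (normal_density (\<mu> i) \<sigma>))"
    by (simp add: distr_normal_density_shift assms)
  also have "\<dots> = density (\<Pi>\<^sub>M i\<in>{1..n}. lborel) (\<lambda>y. \<Prod>i\<in>{1..n}. ennreal (normal_density (\<mu> i) \<sigma> (y i)))"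
    by (rule PiM_density)
      (auto intro!: prob_space_imp_sigma_finite prob_space_normal_density assms lborel.sigma_finite_measure_axioms)
  also have "\<dots> = density (\<Pi>\<^sub>M i\<in>{1..n}. lborel) (gauss_density \<sigma> n \<mu>)"
    by (simp add: gauss_density_def prod_ennreal)
  finally show ?thesis .
qed

lemma borel_measurable_gauss_density [measurable]:
  "gauss_density \<sigma> n \<mu> \<in> borel_measurable (\<Pi>\<^sub>M i\<in>{1..n}. lborel)"
  unfolding gauss_density_def by measurable

text \<open>
  Passing from the noise to the observations turns expectations under different regression functions
  into integrals of the same \<open>g\<close> against different densities, which can be compared pointwise.
\<close>

lemma
  assumes "\<sigma> > 0" and g [measurable]: "g \<in> borel_measurable (\<Pi>\<^sub>M i\<in>{1..n}. borel)"
    and bounds: "\<And>y. y \<in> space (\<Pi>\<^sub>M i\<in>{1..n}. (borel :: real measure)) \<Longrightarrow> 0 \<le> g y \<and> g y \<le> 1"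
  shows integrable_gauss_density:
      "integrable (\<Pi>\<^sub>M i\<in>{1..n}. lborel) (\<lambda>y. gauss_density \<sigma> n \<mu> y * g y)"
    and expect_eq_integral_gauss_density: "\<And>f. (\<And>i. i \<in> {1..n} \<Longrightarrow> f (X n i) = \<mu> i) \<Longrightarrow>
      expect \<sigma> X n f g = (\<integral>y. gauss_density \<sigma> n \<mu> y * g y \<partial>(\<Pi>\<^sub>M i\<in>{1..n}. lborel))"
    and expect_le_1: "expect \<sigma> X n f g \<le> 1"
    and expect_complement: "expect \<sigma> X n f (\<lambda>y. 1 - g y) = 1 - expect \<sigma> X n f g"
proof -
  have sets_eq: "sets (\<Pi>\<^sub>M i\<in>{1..n}. lborel :: real measure) = sets (\<Pi>\<^sub>M i\<in>{1..n}. borel)"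
    by (intro sets_PiM_cong) auto
  have [measurable]: "g \<in> borel_measurable (\<Pi>\<^sub>M i\<in>{1..n}. lborel)"
    using g by (subst measurable_cong_sets[OF sets_eq refl])
  have noise_prob: "prob_space (noise \<sigma> n)"
    unfolding noise_def by (intro prob_space_PiM prob_space_normal_density assms)
  have sets_noise: "sets (noise \<sigma> n) = sets (\<Pi>\<^sub>M i\<in>{1..n}. borel)"
    unfolding noise_def by (intro sets_PiM_cong) auto
  have shift [measurable]: "(\<lambda>\<epsilon>. \<lambda>i\<in>{1..n}. \<mu> i + \<epsilon> i) \<in> measurable (noise \<sigma> n) (\<Pi>\<^sub>M i\<in>{1..n}. borel)" for \<mu>
    unfolding measurable_cong_sets[OF sets_noise refl] by measurable
  have shift_space: "(\<lambda>i\<in>{1..n}. \<mu> i + \<epsilon> i) \<in> space (\<Pi>\<^sub>M i\<in>{1..n}. (borel :: real measure))" for \<mu> \<epsilon>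
    by (auto simp: space_PiM)
  have int_shift: "integrable (noise \<sigma> n) (\<lambda>\<epsilon>. g (\<lambda>i\<in>{1..n}. \<mu> i + \<epsilon> i))" for \<mu>
  proof (rule finite_measure.integrable_const_bound[where B=1])
    show "finite_measure (noise \<sigma> n)"
      using noise_prob by (simp add: prob_space_def)
    show "AE \<epsilon> in noise \<sigma> n. norm (g (\<lambda>i\<in>{1..n}. \<mu> i + \<epsilon> i)) \<le> 1"
      using bounds[OF shift_space] by (intro AE_I2) auto
  qed measurable
  then have "integrable (distr (noise \<sigma> n) (\<Pi>\<^sub>M i\<in>{1..n}. borel) (\<lambda>\<epsilon>. \<lambda>i\<in>{1..n}. \<mu> i + \<epsilon> i)) g"
    by (simp only: integrable_distr_eq[OF shift g])
  then show "integrable (\<Pi>\<^sub>M i\<in>{1..n}. lborel) (\<lambda>y. gauss_density \<sigma> n \<mu> y * g y)"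
    unfolding distr_noise_shift[OF \<open>\<sigma> > 0\<close>]
    by (subst (asm) integrable_density) (auto simp: gauss_density_nonneg simp del: One_nat_def)
  show "expect \<sigma> X n f g = (\<integral>y. gauss_density \<sigma> n \<mu> y * g y \<partial>(\<Pi>\<^sub>M i\<in>{1..n}. lborel))"
    if "\<And>i. i \<in> {1..n} \<Longrightarrow> f (X n i) = \<mu> i" for f
  proof -
    have "expect \<sigma> X n f g = (\<integral>\<epsilon>. g (\<lambda>i\<in>{1..n}. \<mu> i + \<epsilon> i) \<partial>noise \<sigma> n)"
      unfolding expect_def using that
      by (intro Bochner_Integration.integral_cong refl arg_cong[where f=g]) (auto simp: fun_eq_iff)
    also have "\<dots> = (\<integral>y. g y \<partial>distr (noise \<sigma> n) (\<Pi>\<^sub>M i\<in>{1..n}. borel) (\<lambda>\<epsilon>. \<lambda>i\<in>{1..n}. \<mu> i + \<epsilon> i))"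
      by (rule integral_distr[OF shift g, symmetric])
    also have "\<dots> = (\<integral>y. gauss_density \<sigma> n \<mu> y * g y \<partial>(\<Pi>\<^sub>M i\<in>{1..n}. lborel))"
      unfolding distr_noise_shift[OF \<open>\<sigma> > 0\<close>]
      by (subst integral_density) (auto simp: gauss_density_nonneg simp del: One_nat_def)
    finally show ?thesis .
  qed
  have int_1: "integrable (noise \<sigma> n) (\<lambda>\<epsilon>. 1 :: real)"
    using noise_prob by (intro finite_measure.integrable_const) (auto simp: prob_space_def)
  have integral_1: "(\<integral>\<epsilon>. 1 \<partial>noise \<sigma> n) = (1 :: real)"
    using noise_prob by (simp add: prob_space.prob_space)
  have "expect \<sigma> X n f g \<le> (\<integral>\<epsilon>. 1 \<partial>noise \<sigma> n)"
    unfolding expect_def using bounds[OF shift_space] by (intro integral_mono int_shift int_1) auto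
  then show "expect \<sigma> X n f g \<le> 1"
    by (simp only: integral_1)
  show "expect \<sigma> X n f (\<lambda>y. 1 - g y) = 1 - expect \<sigma> X n f g"
    unfolding expect_def by (simp only: Bochner_Integration.integral_diff[OF int_1 int_shift] integral_1)
qed

text \<open>
  Two Gaussian shifts in opposite directions have a geometric mean proportional to the unshifted
  density, because the terms linear in \<open>t\<close> cancel in the exponent.
\<close>

lemma normal_density_mult_reflected:
  assumes "\<sigma> > 0"
  shows "normal_density (m + t) \<sigma> x * normal_density (m - t) \<sigma> x =
    exp (- t\<^sup>2 / \<sigma>\<^sup>2) * (normal_density m \<sigma> x)\<^sup>2"
  using assms
  by (simp add: normal_density_def power_mult_distrib power_divide mult_exp_exp exp_double[symmetric] power2_eq_square
      field_simps)

text \<open>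
  The arithmetic-geometric mean inequality for the two opposite shifts. The factor \<open>exp a\<close> is exactly
  what makes the geometric mean equal to the density in the middle.
\<close>

lemma two_gauss_density_le:
  fixes \<theta> :: "nat \<Rightarrow> real"
  assumes "\<sigma> > 0"
  shows "2 * gauss_density \<sigma> n \<mu> y \<le>
    exp ((\<Sum>i\<in>{1..n}. (\<theta> i)\<^sup>2) / \<sigma>\<^sup>2) * gauss_density \<sigma> n (\<lambda>i. \<mu> i + \<theta> i) y + gauss_density \<sigma> n (\<lambda>i. \<mu> i - \<theta> i) y"
proof -
  define a where "a = (\<Sum>i\<in>{1..n}. (\<theta> i)\<^sup>2) / \<sigma>\<^sup>2"
  define p q r where "p = gauss_density \<sigma> n \<mu> y"
    and "q = gauss_density \<sigma> n (\<lambda>i. \<mu> i + \<theta> i) y" and "r = gauss_density \<sigma> n (\<lambda>i. \<mu> i - \<theta> i) y"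
  have nn: "0 \<le> p" "0 \<le> q" "0 \<le> r"
    by (simp_all add: p_def q_def r_def gauss_density_nonneg)
  have "q * r = (\<Prod>i\<in>{1..n}. exp (- (\<theta> i)\<^sup>2 / \<sigma>\<^sup>2) * (normal_density (\<mu> i) \<sigma> (y i))\<^sup>2)"
    unfolding q_def r_def gauss_density_def prod.distrib[symmetric]
    by (simp only: normal_density_mult_reflected[OF \<open>\<sigma> > 0\<close>])
  also have "\<dots> = exp (- a) * p\<^sup>2"
    by (simp add: prod.distrib exp_sum[symmetric] a_def p_def gauss_density_def prod_power_distrib
        sum_divide_distrib sum_negf)
  finally have "(exp a * q) * r = p\<^sup>2"
    by (simp add: mult.assoc exp_minus)
  then have "p = sqrt ((exp a * q) * r)"
    using nn by simp
  also have "\<dots> \<le> (exp a * q + r) / 2"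
    using nn by (intro arith_geo_mean_sqrt) auto
  finally show ?thesis
    by (simp add: p_def q_def r_def a_def)
qed

text \<open>
  No test separates two regression functions better than their distance at the design points allows.
  Averaging the preceding pointwise inequality against \<open>g\<close> involves, besides \<open>f\<close> and \<open>f\<^sub>0\<close>, the mirror
  image \<open>2 f\<^sub>0 - f\<close>; its expectation is bounded trivially by \<open>1\<close>, and this costs nothing essential
  because the expectation under \<open>f\<^sub>0\<close>, which enters with a factor \<open>2\<close>, is close to \<open>1\<close> when \<open>1 - g\<close> is
  a test of small level.
\<close>

lemma expect_ge_two_point:
  assumes "\<sigma> > 0" and g [measurable]: "g \<in> borel_measurable (\<Pi>\<^sub>M i\<in>{1..n}. borel)"
    and bounds: "\<And>y. y \<in> space (\<Pi>\<^sub>M i\<in>{1..n}. (borel :: real measure)) \<Longrightarrow> 0 \<le> g y \<and> g y \<le> 1"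
  shows "exp (- (\<Sum>i\<in>{1..n}. (f (X n i) - f\<^sub>0 (X n i))\<^sup>2) / \<sigma>\<^sup>2) * (2 * expect \<sigma> X n f\<^sub>0 g - 1)
    \<le> expect \<sigma> X n f g"
proof -
  define \<theta> where "\<theta> i = f (X n i) - f\<^sub>0 (X n i)" for i
  define a where "a = (\<Sum>i\<in>{1..n}. (\<theta> i)\<^sup>2) / \<sigma>\<^sup>2"
  let ?L = "\<Pi>\<^sub>M i\<in>{1..n}. lborel :: real measure"
  let ?\<mu> = "\<lambda>i. f\<^sub>0 (X n i)"
  let ?f' = "\<lambda>x. 2 * f\<^sub>0 x - f x"
  note int = integrable_gauss_density[OF assms]
  note eq = expect_eq_integral_gauss_density[OF assms, where X=X]
  have "2 * expect \<sigma> X n f\<^sub>0 g = (\<integral>y. 2 * gauss_density \<sigma> n ?\<mu> y * g y \<partial>?L)"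
    using eq[of f\<^sub>0 ?\<mu>] by (simp add: mult.assoc)
  also have "\<dots> \<le> (\<integral>y. exp a * (gauss_density \<sigma> n (\<lambda>i. ?\<mu> i + \<theta> i) y * g y) +
      gauss_density \<sigma> n (\<lambda>i. ?\<mu> i - \<theta> i) y * g y \<partial>?L)"
  proof (rule integral_mono)
    fix y assume "y \<in> space ?L"
    then have "0 \<le> g y"
      using bounds by (auto simp: space_PiM)
    from mult_right_mono[OF two_gauss_density_le[OF \<open>\<sigma> > 0\<close>, of n ?\<mu> y \<theta>] this]
    show "2 * gauss_density \<sigma> n ?\<mu> y * g y \<le> exp a * (gauss_density \<sigma> n (\<lambda>i. ?\<mu> i + \<theta> i) y * g y) +
      gauss_density \<sigma> n (\<lambda>i. ?\<mu> i - \<theta> i) y * g y"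
      by (simp add: a_def algebra_simps)
  qed (use int in \<open>auto simp: mult.assoc\<close>)
  also have "\<dots> = exp a * expect \<sigma> X n f g + expect \<sigma> X n ?f' g"
    using int eq[of f "\<lambda>i. ?\<mu> i + \<theta> i"] eq[of ?f' "\<lambda>i. ?\<mu> i - \<theta> i"]
    by (subst Bochner_Integration.integral_add) (auto simp: \<theta>_def)
  also have "expect \<sigma> X n ?f' g \<le> 1"
    by (rule expect_le_1[OF assms])
  finally have "2 * expect \<sigma> X n f\<^sub>0 g - 1 \<le> exp a * expect \<sigma> X n f g"
    by simp
  then have "exp (- a) * (2 * expect \<sigma> X n f\<^sub>0 g - 1) \<le> exp (- a) * (exp a * expect \<sigma> X n f g)"
    by (intro mult_left_mono) auto
  also have "\<dots> = expect \<sigma> X n f g"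
    by (simp add: mult.assoc[symmetric] mult_exp_exp)
  finally show ?thesis
    by (simp add: a_def \<theta>_def)
qed

section \<open>Continuity and support of the wavelets\<close>

lemma daubechies_pair_of_cdv_basis:
  assumes "cdv_basis \<eta> J W"
  shows "daubechies_pair (moments W) (filt W) (father W) (mother W)"
  using assms by (simp add: cdv_basis_def cdv_generators_def)

lemma cdv_basis_moments_pos:
  assumes "cdv_basis \<eta> J W"
  shows "1 \<le> moments W"
  using daubechies_pair_of_cdv_basis[OF assms] unfolding daubechies_pair_def daubechies_filter_def by blast

lemma continuous_father:
  assumes "cdv_basis \<eta> J W" "\<eta> > 0"
  shows "continuous_on A (father W)"
proof -
  have "father W field_differentiable (at x)" for x
    using assms by (auto simp: cdv_basis_def dest!: spec[of _ "0 :: nat"])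
  then show ?thesis
    by (intro continuous_at_imp_continuous_on ballI field_differentiable_imp_continuous_at)
qed

lemma mother_eq:
  assumes "cdv_basis \<eta> J W"
  shows "mother W x = sqrt 2 *
    (\<Sum>k\<in>{1 - int (moments W)..int (moments W)}.
      (- 1) powi k * filt W (1 - k) * father W (2 * x - real_of_int k))"
  using daubechies_pair_of_cdv_basis[OF assms] unfolding daubechies_pair_def by blast

lemma continuous_mother:
  assumes "cdv_basis \<eta> J W" "\<eta> > 0"
  shows "continuous_on A (mother W)"
  unfolding mother_eq[OF assms(1), abs_def]
  by (intro continuous_intros continuous_on_compose2[OF continuous_father[OF assms, of UNIV]]) auto

text \<open>
  The filter has support \<open>[1 - p, p]\<close>, as has the father, so the scaling equation gives
  \<open>2 x \<in> [2 - 2 p, 2 p]\<close> wherever the mother does not vanish.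
\<close>

lemma mother_support:
  assumes W: "cdv_basis \<eta> J W" and "mother W x \<noteq> 0"
  shows "1 - real (moments W) \<le> x" "x \<le> real (moments W)"
proof -
  let ?p = "moments W"
  from assms(2) have "(\<Sum>k\<in>{1 - int ?p..int ?p}.
      (- 1) powi k * filt W (1 - k) * father W (2 * x - real_of_int k)) \<noteq> 0"
    unfolding mother_eq[OF W] by simp
  then obtain k where k: "k \<in> {1 - int ?p..int ?p}" "father W (2 * x - real_of_int k) \<noteq> 0"
    by (rule sum.not_neutral_contains_not_neutral) auto
  have supp: "\<And>y. y \<notin> {1 - real ?p..real ?p} \<Longrightarrow> father W y = 0"
    using daubechies_pair_of_cdv_basis[OF W] unfolding daubechies_pair_def by blast
  have "2 * x - real_of_int k \<in> {1 - real ?p..real ?p}"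
    using k(2) supp by blast
  moreover have "1 - real ?p \<le> real_of_int k" "real_of_int k \<le> real ?p"
    using k(1) by auto
  ultimately show "1 - real ?p \<le> x" "x \<le> real ?p"
    by auto
qed

lemma mother_bounded:
  assumes W: "cdv_basis \<eta> J W" "\<eta> > 0"
  obtains C where "C > 0" "\<And>x. \<bar>mother W x\<bar> \<le> C"
proof -
  have "compact (mother W ` {1 - real (moments W)..real (moments W)})"
    by (intro compact_continuous_image continuous_mother[OF W]) simp
  then obtain C where C: "C > 0" "\<And>x. x \<in> {1 - real (moments W)..real (moments W)} \<Longrightarrow> \<bar>mother W x\<bar> \<le> C"
    by (auto dest!: compact_imp_bounded simp: bounded_pos)
  have "\<bar>mother W x\<bar> \<le> C" for x
  proof (cases "mother W x = 0")
    case False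
    then show ?thesis using mother_support[OF W(1)] C(2) by auto
  qed (use C(1) in auto)
  with C(1) show ?thesis by (rule that)
qed

lemma continuous_on_orthonormalizes:
  assumes "orthonormalizes p v u" "\<And>i. i < p \<Longrightarrow> continuous_on A (v i)" "k < p"
  shows "continuous_on A (u k)"
proof -
  obtain c where c: "\<And>x. u k x = (\<Sum>i<p. c k i * v i x)"
    using assms(1,3) by (auto simp: orthonormalizes_def)
  show ?thesis
    unfolding c[abs_def] using assms(2) by (intro continuous_intros) auto
qed

text \<open>
  At \<open>0\<close> the edge functions jump down to the value \<open>0\<close> on the negative axis, so that continuity holds
  only on the closed half-line. This suffices on the unit interval, whose points have nonnegative
  scaled distance to either end.
\<close>

lemma continuous_edge_father:
  assumes "continuous_on UNIV \<phi>"
  shows "continuous_on {0..} (edge_father p \<phi> k)"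
proof (rule continuous_on_eq)
  show "continuous_on {0..} (\<lambda>x. \<Sum>n=k..2 * p - 2. real (n choose k) * \<phi> (x + real n - real p + 1))"
    by (intro continuous_intros continuous_on_compose2[OF assms]) auto
qed (simp add: edge_father_def)

lemma continuous_edge_mother:
  assumes "\<And>i. i < p \<Longrightarrow> continuous_on {0..} (u i)" "k < p"
  shows "continuous_on {0..} (edge_mother p u k)"
  unfolding edge_mother_def[abs_def] using assms
  by (intro continuous_intros continuous_on_compose2[OF assms(1), of k]) auto

lemma
  assumes W: "cdv_basis \<eta> J W" "\<eta> > 0" and k: "k < moments W"
  shows continuous_left_father: "continuous_on {0..} (left_father W k)"
    and continuous_left_mother: "continuous_on {0..} (left_mother W k)"
    and continuous_right_father: "continuous_on {0..} (right_father W k)"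
    and continuous_right_mother: "continuous_on {0..} (right_mother W k)"
proof -
  have ortho:
    "orthonormalizes (moments W) (edge_father (moments W) (father W)) (left_father W)"
    "orthonormalizes (moments W) (edge_mother (moments W) (left_father W)) (left_mother W)"
    "orthonormalizes (moments W) (edge_father (moments W) (\<lambda>x. father W (1 - x))) (right_father W)"
    "orthonormalizes (moments W) (edge_mother (moments W) (right_father W)) (right_mother W)"
    using W(1) by (auto simp: cdv_basis_def cdv_generators_def)
  have refl: "continuous_on UNIV (\<lambda>x. father W (1 - x))"
    by (intro continuous_intros continuous_on_compose2[OF continuous_father[OF W, of UNIV]]) auto
  have l: "continuous_on {0..} (left_father W i)" if "i < moments W" for i
    by (rule continuous_on_orthonormalizes[OF ortho(1) _ that])
      (intro continuous_edge_father continuous_father[OF W])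
  have r: "continuous_on {0..} (right_father W i)" if "i < moments W" for i
    by (rule continuous_on_orthonormalizes[OF ortho(3) _ that]) (intro continuous_edge_father refl)
  show "continuous_on {0..} (left_father W k)" "continuous_on {0..} (right_father W k)"
    using l r k by auto
  show "continuous_on {0..} (left_mother W k)"
    by (rule continuous_on_orthonormalizes[OF ortho(2) _ k]) (intro continuous_edge_mother l)
  show "continuous_on {0..} (right_mother W k)"
    by (rule continuous_on_orthonormalizes[OF ortho(4) _ k]) (intro continuous_edge_mother r)
qed

lemma
  assumes W: "cdv_basis \<eta> J W" "\<eta> > 0" and k: "k < 2 ^ j"
  shows continuous_phi: "continuous_on {0..1} (phi W j k)"
    and continuous_psi: "continuous_on {0..1} (psi W j k)"
proof -
  have right: "2 ^ j - 1 - k < moments W" if "\<not> k < 2 ^ j - moments W"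
    using that k cdv_basis_moments_pos[OF W(1)] by linarith
  have side: "k < moments W \<or> \<not> k < moments W \<and> k < 2 ^ j - moments W \<or>
      \<not> k < moments W \<and> \<not> k < 2 ^ j - moments W"
    by blast
  show "continuous_on {0..1} (phi W j k)"
    using side
  proof (elim disjE conjE)
    assume k': "k < moments W"
    have "continuous_on {0..1} (\<lambda>x. 2 powr (real j / 2) * left_father W k (2 ^ j * x))"
      by (intro continuous_intros continuous_on_compose2[OF continuous_left_father[OF W k']]) auto
    with k' show "continuous_on {0..1} (phi W j k)"
      by (simp add: phi_def[abs_def])
  next
    assume k': "\<not> k < moments W" "k < 2 ^ j - moments W"
    have "continuous_on {0..1} (\<lambda>x. 2 powr (real j / 2) * father W (2 ^ j * x - real k))"
      by (intro continuous_intros continuous_on_compose2[OF continuous_father[OF W, of UNIV]]) auto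
    with k' show "continuous_on {0..1} (phi W j k)"
      by (simp add: phi_def[abs_def])
  next
    assume k': "\<not> k < moments W" "\<not> k < 2 ^ j - moments W"
    have "continuous_on {0..1} (\<lambda>x. 2 powr (real j / 2) * right_father W (2 ^ j - 1 - k) (2 ^ j * (1 - x)))"
      by (intro continuous_intros continuous_on_compose2[OF continuous_right_father[OF W right[OF k'(2)]]]) auto
    with k' show "continuous_on {0..1} (phi W j k)"
      by (simp add: phi_def[abs_def])
  qed
  show "continuous_on {0..1} (psi W j k)"
    using side
  proof (elim disjE conjE)
    assume k': "k < moments W"
    have "continuous_on {0..1} (\<lambda>x. 2 powr (real j / 2) * left_mother W k (2 ^ j * x))"
      by (intro continuous_intros continuous_on_compose2[OF continuous_left_mother[OF W k']]) auto
    with k' show "continuous_on {0..1} (psi W j k)"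
      by (simp add: psi_def[abs_def])
  next
    assume k': "\<not> k < moments W" "k < 2 ^ j - moments W"
    have "continuous_on {0..1} (\<lambda>x. 2 powr (real j / 2) * mother W (2 ^ j * x - real k))"
      by (intro continuous_intros continuous_on_compose2[OF continuous_mother[OF W, of UNIV]]) auto
    with k' show "continuous_on {0..1} (psi W j k)"
      by (simp add: psi_def[abs_def])
  next
    assume k': "\<not> k < moments W" "\<not> k < 2 ^ j - moments W"
    have "continuous_on {0..1} (\<lambda>x. 2 powr (real j / 2) * right_mother W (2 ^ j - 1 - k) (2 ^ j * (1 - x)))"
      by (intro continuous_intros continuous_on_compose2[OF continuous_right_mother[OF W right[OF k'(2)]]]) auto
    with k' show "continuous_on {0..1} (psi W j k)"
      by (simp add: psi_def[abs_def])
  qed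
qed

text \<open>
  The position \<open>k = p\<close> is the first interior one. Its wavelet lives in \<open>[1 / 2 ^ j, 2 p / 2 ^ j]\<close>, so that
  counting design points in the support only involves an interval starting at \<open>0\<close>.
\<close>

lemma psi_corner:
  assumes "2 * moments W < 2 ^ j"
  shows "psi W j (moments W) x = 2 powr (real j / 2) * mother W (2 ^ j * x - real (moments W))"
proof -
  have "moments W < 2 ^ j - moments W"
    using assms by linarith
  then show ?thesis
    by (simp add: psi_def)
qed

lemma mother_nonzero:
  assumes W: "cdv_basis \<eta> J W"
  obtains x where "mother W x \<noteq> 0"
proof -
  obtain j where j: "J \<le> j" "2 * moments W < 2 ^ j"
  proof
    show "J \<le> J + 2 * moments W" by simp
    have "2 * moments W < 2 ^ (2 * moments W)" by (rule less_exp)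
    also have "\<dots> \<le> 2 ^ (J + 2 * moments W)" by (intro power_increasing) auto
    finally show "2 * moments W < 2 ^ (J + 2 * moments W)" .
  qed
  have "inner01 (psi W j (moments W)) (psi W j (moments W)) = 1"
    using W j by (simp add: cdv_basis_def orthonormal_basis01_def)
  then have "\<not> (\<forall>x. mother W x = 0)"
    by (intro notI) (simp add: inner01_def psi_corner[OF j(2)] set_lebesgue_integral_def)
  then show ?thesis using that by blast
qed

section \<open>Orthonormality of tensor wavelets\<close>

lemma unit_cube_eq_cbox: "unit_cube = cbox (0 :: real ^ 'd::finite) (\<chi> l. 1)"
  by (auto simp: unit_cube_def mem_box_cart)

lemma compact_unit_cube [simp]: "compact (unit_cube :: (real ^ 'd::finite) set)"
  by (simp add: unit_cube_eq_cbox)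

text \<open>
  Fubini's theorem in coordinates: \<open>lborel\<close> is the image of a product measure indexed by the standard
  basis vectors, which correspond to the index type via \<open>l \<mapsto> axis l 1\<close>.
\<close>

lemma integral_prod_cart:
  fixes g :: "'d::finite \<Rightarrow> real \<Rightarrow> real"
  assumes int: "\<And>l. integrable lborel (g l)"
  shows "(LINT x|lborel. (\<Prod>l\<in>UNIV. g l ((x :: real ^ 'd) $ l))) = (\<Prod>l\<in>UNIV. LINT x|lborel. g l x)"
proof -
  let ?e = "\<lambda>l. axis l 1 :: real ^ 'd"
  have inj: "inj ?e"
    by (auto simp: inj_def axis_eq_axis)
  have Basis: "Basis = range ?e"
    by (auto simp: Basis_vec_def)
  have [measurable]: "g l \<in> borel_measurable borel" for l
    using int[of l] by simp
  interpret product_sigma_finite "\<lambda>b :: real ^ 'd. lborel :: real measure"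
    by standard
  have coord: "(\<Sum>b\<in>Basis. f b *\<^sub>R b) $ l = f (?e l)" for f :: "real ^ 'd \<Rightarrow> real" and l
  proof -
    have "(\<Sum>b\<in>Basis. f b *\<^sub>R b) $ l = (\<Sum>b\<in>Basis. f b *\<^sub>R b) \<bullet> ?e l"
      by (simp add: inner_axis)
    also have "\<dots> = f (?e l)"
      by (subst inner_sum_left_Basis) (auto simp: Basis)
    finally show ?thesis .
  qed
  have reindex: "(\<Prod>b\<in>Basis. h (inv ?e b) b) = (\<Prod>l\<in>UNIV. h l (?e l))"
    for h :: "'d \<Rightarrow> real ^ 'd \<Rightarrow> real"
    unfolding Basis by (subst prod.reindex[OF inj]) (simp add: inv_f_f[OF inj])
  have "(LINT x|lborel. (\<Prod>l\<in>UNIV. g l ((x :: real ^ 'd) $ l))) =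
      (LINT f|(\<Pi>\<^sub>M b\<in>Basis. lborel). (\<Prod>l\<in>UNIV. g l ((\<Sum>b\<in>Basis. f b *\<^sub>R b :: real ^ 'd) $ l)))"
    by (subst lborel_eq, rule integral_distr) measurable
  also have "\<dots> = (LINT f|(\<Pi>\<^sub>M b\<in>Basis. lborel). (\<Prod>b\<in>Basis. g (inv ?e b) (f b)))"
    by (simp only: coord reindex[where h="\<lambda>l b. g l (f b)" for f])
  also have "\<dots> = (\<Prod>b\<in>Basis. LINT x|lborel. g (inv ?e b) x)"
    by (intro product_integral_prod int) auto
  also have "\<dots> = (\<Prod>l\<in>UNIV. LINT x|lborel. g l x)"
    by (rule reindex)
  finally show ?thesis .
qed

lemma cube_inner_prod:
  fixes f g :: "'d::finite \<Rightarrow> real \<Rightarrow> real"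
  assumes "\<And>l. continuous_on {0..1} (f l)" "\<And>l. continuous_on {0..1} (g l)"
  shows "cube_inner (\<lambda>x. \<Prod>l\<in>UNIV. f l (x $ l)) (\<lambda>x. \<Prod>l\<in>UNIV. g l (x $ l)) =
    (\<Prod>l\<in>UNIV. inner01 (f l) (g l))"
proof -
  let ?h = "\<lambda>l x. indicator {0..1} x * (f l x * g l x)"
  have ind: "indicator unit_cube x = (\<Prod>l\<in>UNIV. indicator {0..1} (x $ l) :: real)" for x :: "real ^ 'd"
    by (auto simp: unit_cube_def indicator_def)
  have "cube_inner (\<lambda>x. \<Prod>l\<in>UNIV. f l (x $ l)) (\<lambda>x. \<Prod>l\<in>UNIV. g l (x $ l)) =
      (LINT x|lborel. (\<Prod>l\<in>UNIV. ?h l ((x :: real ^ 'd) $ l)))"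
    by (simp add: cube_inner_def set_lebesgue_integral_def ind prod.distrib)
  also have "\<dots> = (\<Prod>l\<in>UNIV. LINT x|lborel. ?h l x)"
  proof (rule integral_prod_cart)
    fix l
    have "set_integrable lborel {0..1} (\<lambda>x. f l x * g l x)"
      by (intro borel_integrable_atLeastAtMost' continuous_intros assms)
    then show "integrable lborel (?h l)"
      by (simp add: set_integrable_def)
  qed
  finally show ?thesis
    by (simp add: inner01_def set_lebesgue_integral_def)
qed

lemma cube_inner_add_scaled:
  assumes "continuous_on unit_cube f" "continuous_on unit_cube g" "continuous_on unit_cube h"
  shows "cube_inner (\<lambda>x. f x + c * g x) h = cube_inner f h + c * cube_inner g h"
proof -
  have int: "set_integrable lborel unit_cube (\<lambda>x. u x * h x)" if "continuous_on unit_cube u" for u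
    unfolding set_integrable_def
    by (rule borel_integrable_compact) (auto intro!: continuous_intros that assms(3))
  have "cube_inner (\<lambda>x. f x + c * g x) h = (LINT x:unit_cube|lborel. f x * h x + c * (g x * h x))"
    by (simp add: cube_inner_def algebra_simps)
  also have "\<dots> = cube_inner f h + c * cube_inner g h"
    using int[OF assms(1)] int[OF assms(2)] by (simp add: cube_inner_def set_integral_add)
  finally show ?thesis .
qed

text \<open>
  One name for both kinds of factor, so that the pure, the mixed and the father products are all of
  the form \<open>tensor_psi W S\<close>, the father products with \<open>S = {}\<close>.
\<close>

definition tensor_factor :: "cdv \<Rightarrow> bool \<Rightarrow> nat \<Rightarrow> nat \<Rightarrow> real \<Rightarrow> real" where
  "tensor_factor W b = (if b then psi W else phi W)"

lemma tensor_psi_eq: "tensor_psi W S j k x = (\<Prod>l\<in>UNIV. tensor_factor W (l \<in> S) (j l) (k l) (x $ l))"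
  by (auto simp: tensor_psi_def tensor_factor_def intro!: prod.cong)

lemma tensor_phi_eq_psi: "tensor_phi W N m = tensor_psi W {} N m"
  by (simp add: fun_eq_iff tensor_phi_def tensor_psi_def)

lemma continuous_tensor_factor:
  assumes "cdv_basis \<eta> J W" "\<eta> > 0" "k < 2 ^ j"
  shows "continuous_on {0..1} (tensor_factor W b j k)"
  using continuous_phi[OF assms] continuous_psi[OF assms] by (simp add: tensor_factor_def)

lemma continuous_tensor_psi:
  assumes "cdv_basis \<eta> J W" "\<eta> > 0" "k \<in> positions j"
  shows "continuous_on unit_cube (tensor_psi W S j k)"
  unfolding tensor_psi_eq[abs_def] using assms(3)
  by (intro continuous_intros continuous_on_compose2[OF continuous_tensor_factor[OF assms(1,2)]])
    (auto simp: positions_def unit_cube_def)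

lemma inner01_psi_tensor_factor:
  assumes W: "cdv_basis \<eta> J W" and "J \<le> i" "m < 2 ^ i" "J \<le> j" "k < 2 ^ j" "b \<or> j = J"
  shows "inner01 (psi W i m) (tensor_factor W b j k) = (if b \<and> i = j \<and> m = k then 1 else 0)"
proof -
  have ortho: "orthonormal_basis01 W J"
    using W by (simp add: cdv_basis_def)
  have comm: "inner01 f g = inner01 g f" for f g
    by (simp add: inner01_def mult.commute)
  show ?thesis
  proof (cases b)
    case True
    then show ?thesis using ortho assms by (simp add: orthonormal_basis01_def tensor_factor_def)
  next
    case False
    then show ?thesis using ortho assms
      by (simp add: orthonormal_basis01_def tensor_factor_def comm[of "psi W i m"])
  qed
qed

text \<open>
  Orthonormality is inherited coordinate by coordinate. The first function stands for the perturbation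
  of \<open>f\<^sub>0\<close>, which is a pure mother product; the second runs through the whole basis. Where the second
  carries a father factor, its level must be the starting level of that coordinate, because the
  one-dimensional bases may start at different levels.
\<close>

lemma cube_inner_tensor_psi:
  fixes N :: "'d::finite \<Rightarrow> nat"
  assumes W: "\<And>l. cdv_basis \<eta> (N l) W" "\<eta> > 0"
    and i: "\<And>l. N l \<le> i l" "m \<in> positions i"
    and j: "\<And>l. N l \<le> j l" "\<And>l. l \<notin> S \<Longrightarrow> j l = N l" "k \<in> positions j"
  shows "cube_inner (tensor_psi W UNIV i m) (tensor_psi W S j k) =
    (if S = UNIV \<and> i = j \<and> m = k then 1 else 0)"
proof -
  have cont: "continuous_on {0..1} (tensor_factor W b (i' l) (m' l))" if "m' \<in> positions i'"
    for b i' m' and l :: 'd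
    using that by (intro continuous_tensor_factor[OF W]) (auto simp: positions_def)
  have "cube_inner (tensor_psi W UNIV i m) (tensor_psi W S j k) =
      (\<Prod>l\<in>UNIV. inner01 (tensor_factor W (l \<in> UNIV) (i l) (m l)) (tensor_factor W (l \<in> S) (j l) (k l)))"
    unfolding tensor_psi_eq[abs_def] by (intro cube_inner_prod cont i j)
  also have "\<dots> = (\<Prod>l\<in>UNIV. inner01 (psi W (i l) (m l)) (tensor_factor W (l \<in> S) (j l) (k l)))"
    by (simp add: tensor_factor_def)
  also have "\<dots> = (\<Prod>l\<in>UNIV. if l \<in> S \<and> i l = j l \<and> m l = k l then 1 else 0)"
    using i j by (intro prod.cong refl inner01_psi_tensor_factor[OF W(1)]) (auto simp: positions_def)
  also have "\<dots> = (if S = UNIV \<and> i = j \<and> m = k then 1 else 0)"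
  proof (cases "S = UNIV \<and> i = j \<and> m = k")
    case False
    then have "\<exists>l\<in>UNIV. (if l \<in> S \<and> i l = j l \<and> m l = k l then 1 else 0) = (0 :: real)"
      by (auto simp: fun_eq_iff)
    then show ?thesis
      using False by (subst prod_zero) auto
  qed auto
  finally show ?thesis .
qed

section \<open>Adding a wavelet inside a Besov ball\<close>

definition besov_weight :: "real ^ 'd::finite \<Rightarrow> ('d \<Rightarrow> nat) \<Rightarrow> real" where
  "besov_weight \<alpha> j = 2 powr (\<Sum>l\<in>UNIV. \<alpha> $ l * real (j l) *
     (1 / real CARD('d) + 1 / (2 * harmonic_mean \<alpha>)))"

lemma besov_weight_pos: "0 < besov_weight \<alpha> j"
  by (simp add: besov_weight_def)

lemma finite_positions: "finite (positions (j :: 'd::finite \<Rightarrow> nat))"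
proof -
  have "positions j = (\<Pi>\<^sub>E l\<in>UNIV. {..<2 ^ j l})"
    by (auto simp: positions_def)
  then show ?thesis
    by (simp add: finite_PiE)
qed

lemma positions_nonempty: "positions j \<noteq> {}"
  by (auto simp: positions_def intro!: exI[of _ "\<lambda>_. 0"])

lemma besov_norm_le_iff:
  "besov_norm W N \<alpha> f \<le> ereal R \<longleftrightarrow>
    (\<forall>(S, j)\<in>levels N. \<forall>k\<in>positions j.
      besov_weight \<alpha> j * \<bar>cube_inner f (tensor_psi W S j k)\<bar> \<le> R - father_norm W N f)"
proof -
  define m where "m S j = (MAX k\<in>positions j. \<bar>cube_inner f (tensor_psi W S j k)\<bar>)" for S j
  have add: "ereal F + s \<le> ereal R \<longleftrightarrow> s \<le> ereal (R - F)" for F s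
    by (cases s) auto
  have max: "besov_weight \<alpha> j * m S j \<le> B \<longleftrightarrow>
      (\<forall>k\<in>positions j. besov_weight \<alpha> j * \<bar>cube_inner f (tensor_psi W S j k)\<bar> \<le> B)" for S j B
  proof -
    have "besov_weight \<alpha> j * x \<le> B \<longleftrightarrow> x \<le> B / besov_weight \<alpha> j" for x
      by (simp add: pos_le_divide_eq[OF besov_weight_pos] mult.commute)
    then show ?thesis
      by (simp add: m_def Max_le_iff finite_positions positions_nonempty)
  qed
  have "besov_norm W N \<alpha> f \<le> ereal R \<longleftrightarrow>
      (\<forall>(S, j)\<in>levels N. ereal (besov_weight \<alpha> j * m S j) \<le> ereal (R - father_norm W N f))"
    by (auto simp: besov_norm_def add SUP_le_iff besov_weight_def m_def)
  then show ?thesis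
    by (simp add: max)
qed

text \<open>
  By orthonormality the added wavelet changes a single mother coefficient of \<open>f\<close>. If its sign is
  opposite to that of the coefficient, the new coefficient is in absolute value at most the maximum
  of the old one and of \<open>c\<close>. Hence the room \<open>R - father_norm W N f\<close> left by the father coefficients is
  all available, even if \<open>f\<close> itself lies on the boundary of the ball.
\<close>

lemma besov_ball_add_wavelet:
  fixes N :: "'d::finite \<Rightarrow> nat"
  assumes W: "\<And>l. cdv_basis \<eta> (N l) W" "\<eta> > 0"
    and f: "f \<in> besov_ball W N \<alpha> R"
    and i: "\<And>l. N l \<le> i l" "m \<in> positions i"
    and c: "0 \<le> c" "besov_weight \<alpha> i * c \<le> R - father_norm W N f"
  obtains c' where "\<bar>c'\<bar> = c" "(\<lambda>x. f x + c' * tensor_psi W UNIV i m x) \<in> besov_ball W N \<alpha> R"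
proof
  let ?\<psi> = "tensor_psi W UNIV i m"
  define c' where "c' = (if 0 \<le> cube_inner f ?\<psi> then - c else c)"
  let ?g = "\<lambda>x. f x + c' * ?\<psi> x"
  show "\<bar>c'\<bar> = c"
    using c by (auto simp: c'_def)
  have cont_f: "continuous_on unit_cube f"
    using f by (simp add: besov_ball_def uniformly_continuous_imp_continuous)
  have cont_psi: "continuous_on unit_cube (tensor_psi W S j k)" if "k \<in> positions j" for S j k
    by (rule continuous_tensor_psi[OF W that])
  have coeff: "cube_inner ?g (tensor_psi W S j k) =
      cube_inner f (tensor_psi W S j k) + c' * (if S = UNIV \<and> i = j \<and> m = k then 1 else 0)"
    if "\<And>l. N l \<le> j l" "\<And>l. l \<notin> S \<Longrightarrow> j l = N l" "k \<in> positions j" for S j k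
    using cube_inner_tensor_psi[OF W i that]
    by (simp add: cube_inner_add_scaled[OF cont_f cont_psi[OF i(2)] cont_psi[OF that(3)]])
  have father: "father_norm W N ?g = father_norm W N f"
    unfolding father_norm_def tensor_phi_eq_psi
    by (intro arg_cong[where f=Max] image_cong refl) (simp add: coeff)
  have f_le: "besov_weight \<alpha> j * \<bar>cube_inner f (tensor_psi W S j k)\<bar> \<le> R - father_norm W N f"
    if "(S, j) \<in> levels N" "k \<in> positions j" for S j k
    using f that unfolding besov_ball_def mem_Collect_eq besov_norm_le_iff by blast
  have "besov_norm W N \<alpha> ?g \<le> ereal R"
    unfolding besov_norm_le_iff father
  proof (intro ballI, clarify)
    fix S j k assume Sj: "(S, j) \<in> levels N" and k: "k \<in> positions j"
    have c_eq: "cube_inner ?g (tensor_psi W S j k) =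
      cube_inner f (tensor_psi W S j k) + c' * (if S = UNIV \<and> i = j \<and> m = k then 1 else 0)"
      using Sj k by (intro coeff) (auto simp: levels_def)
    show "besov_weight \<alpha> j * \<bar>cube_inner ?g (tensor_psi W S j k)\<bar> \<le> R - father_norm W N f"
    proof (cases "S = UNIV \<and> i = j \<and> m = k")
      case True
      have "\<bar>cube_inner ?g (tensor_psi W S j k)\<bar> \<le> max \<bar>cube_inner f (tensor_psi W S j k)\<bar> c"
        unfolding c_eq using True c(1) by (auto simp: c'_def)
      then have "besov_weight \<alpha> j * \<bar>cube_inner ?g (tensor_psi W S j k)\<bar> \<le>
          besov_weight \<alpha> j * max \<bar>cube_inner f (tensor_psi W S j k)\<bar> c"
        by (intro mult_left_mono) (auto simp: besov_weight_pos less_imp_le)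
      also have "\<dots> \<le> R - father_norm W N f"
        using f_le[OF Sj k] c(2) True by (auto simp: max_def)
      finally show ?thesis .
    qed (use f_le[OF Sj k] c_eq in auto)
  qed
  moreover have "uniformly_continuous_on unit_cube ?g"
    by (intro compact_uniformly_continuous continuous_intros cont_f cont_psi i(2) compact_unit_cube)
  ultimately show "?g \<in> besov_ball W N \<alpha> R"
    by (simp add: besov_ball_def)
qed

section \<open>The tensor wavelet in the corner of the cube\<close>

abbreviation corner_psi :: "cdv \<Rightarrow> ('d::finite \<Rightarrow> nat) \<Rightarrow> real ^ 'd \<Rightarrow> real" where
  "corner_psi W j \<equiv> tensor_psi W UNIV j (\<lambda>_. moments W)"

lemma corner_position:
  assumes "\<And>l. 2 * moments W < 2 ^ j l"
  shows "(\<lambda>_. moments W) \<in> positions j"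
  unfolding positions_def
proof clarify
  fix l show "moments W < 2 ^ j l" using assms[of l] by linarith
qed

lemma corner_psi_eq:
  assumes "\<And>l. 2 * moments W < 2 ^ j l"
  shows "corner_psi W j x =
    2 powr ((\<Sum>l\<in>UNIV. real (j l)) / 2) * (\<Prod>l\<in>UNIV. mother W (2 ^ j l * x $ l - real (moments W)))"
  using assms
  by (simp add: tensor_psi_def psi_corner prod.distrib powr_sum[symmetric] sum_divide_distrib)

lemma sup_dist_ge:
  assumes "continuous_on unit_cube g" "x \<in> unit_cube"
  shows "\<bar>c * g x\<bar> \<le> sup_dist (\<lambda>x. f x + c * g x) f"
proof -
  have "continuous_on unit_cube (\<lambda>x. \<bar>c * g x\<bar>)"
    by (intro continuous_intros assms)
  then have "bdd_above ((\<lambda>x. \<bar>c * g x\<bar>) ` unit_cube)"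
    by (intro bounded_imp_bdd_above compact_imp_bounded compact_continuous_image) auto
  then show ?thesis
    unfolding sup_dist_def using cSUP_upper[OF assms(2)] by simp
qed

lemma sup_dist_corner_psi_ge:
  fixes j :: "'d::finite \<Rightarrow> nat"
  assumes W: "cdv_basis \<eta> J W" "\<eta> > 0" and j: "\<And>l. 2 * moments W < 2 ^ j l"
    and y: "mother W y \<noteq> 0"
  shows "\<bar>c\<bar> * \<bar>mother W y\<bar> ^ CARD('d) * 2 powr ((\<Sum>l\<in>UNIV. real (j l)) / 2)
    \<le> sup_dist (\<lambda>x. f x + c * corner_psi W j x) f"
proof -
  \<comment> \<open>The point of the cube at which every rescaled coordinate equals \<open>y\<close>.\<close>
  define x :: "real ^ 'd" where "x = (\<chi> l. (y + real (moments W)) / 2 ^ j l)"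
  note supp = mother_support[OF W(1) y]
  have bound: "y + real (moments W) \<le> 2 ^ j l" for l
  proof -
    have "real (2 * moments W) \<le> real (2 ^ j l)"
      using j[of l] by (intro of_nat_mono) simp
    then show ?thesis
      using supp(2) by simp
  qed
  then have x: "x \<in> unit_cube"
    using supp(1) by (auto simp: unit_cube_def x_def)
  have "\<bar>corner_psi W j x\<bar> = 2 powr ((\<Sum>l\<in>UNIV. real (j l)) / 2) * \<bar>mother W y\<bar> ^ CARD('d)"
    unfolding corner_psi_eq[OF j] x_def by (simp add: abs_mult power_abs)
  then show ?thesis
    using sup_dist_ge[OF continuous_tensor_psi[OF W corner_position[where j=j, OF j], of UNIV] x, of c f]
    by (simp add: abs_mult ac_simps)
qed

text \<open>
  Design points outside the box \<open>[0, b]\<close>, with sides \<open>2 p / 2 ^ j\<close>, do not see the wavelet, and the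
  number of points inside is \<open>n\<close> times the empirical distribution function at \<open>b\<close>. The bound splits
  into the volume of the box and the discrepancy of the design.
\<close>

lemma sum_corner_psi_design_le:
  fixes j :: "'d::finite \<Rightarrow> nat"
  assumes W: "cdv_basis \<eta> J W" "\<eta> > 0" and j: "\<And>l. 2 * moments W < 2 ^ j l"
    and C: "\<And>y. \<bar>mother W y\<bar> \<le> C"
    and disc: "\<And>x. x \<in> unit_cube \<Longrightarrow> \<bar>empirical_cdf X n x - uniform_cdf x\<bar> \<le> D / real n"
    and X: "\<And>i. i \<in> {1..n} \<Longrightarrow> X n i \<in> unit_cube" and "n > 0"
  shows "(\<Sum>i\<in>{1..n}. (corner_psi W j (X n i))\<^sup>2) \<le>
    C ^ (2 * CARD('d)) * (real (2 * moments W) ^ CARD('d) * real n + D * 2 powr (\<Sum>l\<in>UNIV. real (j l)))"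
proof -
  let ?s = "\<Sum>l\<in>UNIV. real (j l)" and ?p = "moments W"
  define b :: "real ^ 'd" where "b = (\<chi> l. real (2 * ?p) / 2 ^ j l)"
  define I where "I = {i \<in> {1..n}. \<forall>l. X n i $ l \<le> b $ l}"
  have "real (2 * ?p) \<le> real (2 ^ j l)" for l
    using j[of l] by (intro of_nat_mono) simp
  then have b: "b \<in> unit_cube"
    by (auto simp: unit_cube_def b_def)
  have sq: "(corner_psi W j x)\<^sup>2 = 2 powr ?s * (\<Prod>l\<in>UNIV. (mother W (2 ^ j l * x $ l - real ?p))\<^sup>2)" for x
    unfolding corner_psi_eq[OF j]
    by (simp add: power_mult_distrib prod_power_distrib powr_power)
  have le: "(corner_psi W j x)\<^sup>2 \<le> 2 powr ?s * C ^ (2 * CARD('d))" for x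
  proof -
    have "(\<Prod>l\<in>UNIV. (mother W (2 ^ j l * x $ l - real ?p))\<^sup>2) \<le> (\<Prod>l\<in>(UNIV :: 'd set). C\<^sup>2)"
      using C by (intro prod_mono) (auto simp: abs_le_square_iff[symmetric] intro: order_trans[OF _ abs_ge_self])
    then show ?thesis
      by (simp add: sq power_mult)
  qed
  have zero: "corner_psi W j (X n i) = 0" if "i \<in> {1..n}" "i \<notin> I" for i
  proof -
    obtain l where l: "b $ l < X n i $ l"
      using \<open>i \<notin> I\<close> \<open>i \<in> {1..n}\<close> by (auto simp: I_def not_le)
    then have "real ?p < 2 ^ j l * X n i $ l - real ?p"
      by (simp add: b_def field_simps)
    then have "mother W (2 ^ j l * X n i $ l - real ?p) = 0"
      using mother_support(2)[OF W(1)] by (meson not_le)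
    then have "(\<Prod>l\<in>UNIV. mother W (2 ^ j l * X n i $ l - real ?p)) = 0"
      by (intro prod_zero) auto
    then show ?thesis
      by (simp add: corner_psi_eq[OF j])
  qed
  have volume: "2 powr ?s * (real n * uniform_cdf b) = real (2 * ?p) ^ CARD('d) * real n"
  proof -
    have "uniform_cdf b = real (2 * ?p) ^ CARD('d) / 2 powr ?s"
      by (simp add: uniform_cdf_def b_def prod_dividef powr_sum powr_realpow)
    then show ?thesis by simp
  qed
  have "real (card I) \<le> real n * uniform_cdf b + D"
  proof -
    have "real (card I) = real n * empirical_cdf X n b"
      using \<open>n > 0\<close> by (simp add: empirical_cdf_def I_def)
    also have "\<dots> \<le> real n * (uniform_cdf b + D / real n)"
      using disc[OF b] by (intro mult_left_mono) auto
    finally show ?thesis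
      using \<open>n > 0\<close> by (simp add: distrib_left)
  qed
  then have "2 powr ?s * real (card I) \<le> 2 powr ?s * (real n * uniform_cdf b + D)"
    by (intro mult_left_mono) auto
  also have "\<dots> = real (2 * ?p) ^ CARD('d) * real n + D * 2 powr ?s"
    unfolding distrib_left volume by (simp add: mult.commute)
  finally have count: "2 powr ?s * real (card I) \<le> real (2 * ?p) ^ CARD('d) * real n + D * 2 powr ?s" .
  have "(\<Sum>i\<in>{1..n}. (corner_psi W j (X n i))\<^sup>2) = (\<Sum>i\<in>I. (corner_psi W j (X n i))\<^sup>2)"
    using zero by (intro sum.mono_neutral_right) (auto simp: I_def)
  also have "\<dots> \<le> real (card I) * (2 powr ?s * C ^ (2 * CARD('d)))"
    using sum_bounded_above[of I "\<lambda>i. (corner_psi W j (X n i))\<^sup>2"] le by simp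
  also have "\<dots> = C ^ (2 * CARD('d)) * (2 powr ?s * real (card I))"
    by simp
  also have "\<dots> \<le> C ^ (2 * CARD('d)) * (real (2 * ?p) ^ CARD('d) * real n + D * 2 powr ?s)"
    by (intro mult_left_mono count) (simp add: power_mult)
  finally show ?thesis .
qed

section \<open>Balanced levels\<close>

lemma sum_inverse_eq_harmonic_mean:
  "(\<Sum>l\<in>UNIV. inverse ((\<alpha> :: real ^ 'd::finite) $ l)) = real CARD('d) / harmonic_mean \<alpha>"
  by (simp add: harmonic_mean_def)

lemma harmonic_mean_pos:
  assumes "\<And>l. 0 < (\<alpha> :: real ^ 'd::finite) $ l"
  shows "0 < harmonic_mean \<alpha>"
  unfolding harmonic_mean_def using assms by (auto intro!: divide_pos_pos sum_pos)

text \<open>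
  The anisotropic levels for which every coordinate contributes the same amount \<open>t\<close>, up to rounding,
  to the exponent of the Besov weight. Rounding upwards makes all levels large with \<open>t\<close>.
\<close>

definition balanced_level :: "real ^ 'd::finite \<Rightarrow> real \<Rightarrow> 'd \<Rightarrow> nat" where
  "balanced_level \<alpha> t l = nat \<lceil>t / \<alpha> $ l\<rceil>"

lemma balanced_level_bounds:
  assumes "0 < \<alpha> $ l" "0 \<le> t"
  shows "t / \<alpha> $ l \<le> real (balanced_level \<alpha> t l)" "real (balanced_level \<alpha> t l) \<le> t / \<alpha> $ l + 1"
proof -
  have "0 \<le> t / \<alpha> $ l" using assms by simp
  then show "t / \<alpha> $ l \<le> real (balanced_level \<alpha> t l)" "real (balanced_level \<alpha> t l) \<le> t / \<alpha> $ l + 1"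
    unfolding balanced_level_def by linarith+
qed

lemma balanced_level_ge:
  assumes "0 < \<alpha> $ l" "real n * \<alpha> $ l \<le> t" "0 \<le> t"
  shows "n \<le> balanced_level \<alpha> t l"
proof -
  have "real n \<le> t / \<alpha> $ l"
    using assms by (simp add: pos_le_divide_eq)
  also have "\<dots> \<le> real (balanced_level \<alpha> t l)"
    by (rule balanced_level_bounds(1)[OF assms(1,3)])
  finally show ?thesis by simp
qed

text \<open>
  The harmonic mean enters because the levels are proportional to \<open>1 / \<alpha> $ l\<close>. Rounding costs only
  constant factors.
\<close>

lemma
  fixes \<alpha> :: "real ^ 'd::finite"
  assumes \<alpha>: "\<And>l. 0 < \<alpha> $ l" and t: "0 \<le> t"
  defines "d \<equiv> real CARD('d)" and "h \<equiv> harmonic_mean \<alpha>"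
  shows sum_balanced_level_ge: "t * d / h \<le> (\<Sum>l\<in>UNIV. real (balanced_level \<alpha> t l))"
    and sum_balanced_level_le: "(\<Sum>l\<in>UNIV. real (balanced_level \<alpha> t l)) \<le> t * d / h + d"
    and besov_weight_balanced_ge: "2 powr (t * (1 + d / (2 * h))) \<le> besov_weight \<alpha> (balanced_level \<alpha> t)"
    and besov_weight_balanced_le: "besov_weight \<alpha> (balanced_level \<alpha> t) \<le>
      2 powr (t * (1 + d / (2 * h)) + (1 / d + 1 / (2 * h)) * (\<Sum>l\<in>UNIV. \<alpha> $ l))"
proof -
  let ?j = "balanced_level \<alpha> t" and ?\<kappa> = "1 / d + 1 / (2 * h)"
  note b = balanced_level_bounds[OF \<alpha> t]
  have h: "0 < h" unfolding h_def by (rule harmonic_mean_pos[OF \<alpha>])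
  have d: "0 < d" by (simp add: d_def)
  have "t * d / h = (\<Sum>l\<in>UNIV. t / \<alpha> $ l)"
    using sum_inverse_eq_harmonic_mean[of \<alpha>]
    by (simp add: divide_inverse sum_distrib_left[symmetric] d_def h_def)
  then show "t * d / h \<le> (\<Sum>l\<in>UNIV. real (?j l))" "(\<Sum>l\<in>UNIV. real (?j l)) \<le> t * d / h + d"
    using sum_mono[of UNIV "\<lambda>l. t / \<alpha> $ l", OF b(1)] sum_mono[of UNIV _ "\<lambda>l. t / \<alpha> $ l + 1", OF b(2)]
    by (simp_all add: sum.distrib d_def)
  have w: "besov_weight \<alpha> ?j = 2 powr ((\<Sum>l\<in>UNIV. \<alpha> $ l * real (?j l)) * ?\<kappa>)"
    by (simp add: besov_weight_def d_def h_def sum_distrib_right)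
  have "t \<le> \<alpha> $ l * real (?j l)" "\<alpha> $ l * real (?j l) \<le> t + \<alpha> $ l" for l
    using mult_left_mono[OF b(1)[of l], of "\<alpha> $ l"] mult_left_mono[OF b(2)[of l], of "\<alpha> $ l"] \<alpha>[of l]
    by (simp_all add: algebra_simps)
  then have s: "d * t \<le> (\<Sum>l\<in>UNIV. \<alpha> $ l * real (?j l))"
      "(\<Sum>l\<in>UNIV. \<alpha> $ l * real (?j l)) \<le> d * t + (\<Sum>l\<in>UNIV. \<alpha> $ l)"
    using sum_mono[of UNIV "\<lambda>l. t" "\<lambda>l. \<alpha> $ l * real (?j l)"]
      sum_mono[of UNIV "\<lambda>l. \<alpha> $ l * real (?j l)" "\<lambda>l. t + \<alpha> $ l"]
    by (simp_all add: sum.distrib d_def)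
  have e: "d * t * ?\<kappa> = t * (1 + d / (2 * h))"
    using d h by (simp add: field_simps)
  have "0 \<le> ?\<kappa>" using d h by simp
  from mult_right_mono[OF s(1) this] mult_right_mono[OF s(2) this]
  show "2 powr (t * (1 + d / (2 * h))) \<le> besov_weight \<alpha> ?j"
    "besov_weight \<alpha> ?j \<le> 2 powr (t * (1 + d / (2 * h)) + ?\<kappa> * (\<Sum>l\<in>UNIV. \<alpha> $ l))"
    unfolding w e[symmetric] by (auto intro!: powr_mono simp: algebra_simps)
qed

section \<open>A bump of given height\<close>

text \<open>
  A perturbation of \<open>f\<^sub>0\<close> of height of order \<open>\<delta>\<close> can be hidden in the ball at a cost, measured at the
  design points, of order \<open>n \<delta> powr (2 + d / h)\<close>. The amplitude \<open>c\<close> is the largest one that the ball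
  allows, and the levels are balanced with \<open>2 powr (- t) = \<delta>\<close>. Up to constants this gives
  \<open>c = \<delta> powr (1 + d / (2 h))\<close>, a wavelet of height \<open>\<delta> powr (- d / (2 h))\<close> and a support of volume
  \<open>\<delta> powr (d / h)\<close>. The discrepancy of the design, through \<open>D\<close>, only contributes a bounded term. The
  same bump serves all designs, which is why \<open>X\<close>, \<open>n\<close> and \<open>D\<close> are quantified inside.
\<close>

lemma besov_ball_bump:
  fixes N :: "'d::finite \<Rightarrow> nat" and \<alpha> :: "real ^ 'd"
  assumes W: "\<And>l. cdv_basis \<eta> (N l) W" "\<eta> > 0" and \<alpha>: "\<And>l. 0 < \<alpha> $ l"
    and f\<^sub>0: "f\<^sub>0 \<in> besov_ball W N \<alpha> R" "father_norm W N f\<^sub>0 < R"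
  defines "d \<equiv> real CARD('d)" and "h \<equiv> harmonic_mean \<alpha>"
  obtains \<kappa> E \<delta>\<^sub>0 where "\<kappa> > 0" "E > 0" "\<delta>\<^sub>0 > 0"
    "\<And>\<delta>. 0 < \<delta> \<Longrightarrow> \<delta> \<le> \<delta>\<^sub>0 \<Longrightarrow> \<exists>f\<in>besov_ball W N \<alpha> R. \<kappa> * \<delta> \<le> sup_dist f f\<^sub>0 \<and>
      (\<forall>X n D. (\<forall>i\<in>{1..n}. X n i \<in> unit_cube) \<and> 0 < n \<and> 0 \<le> D \<and>
          (\<forall>x\<in>unit_cube. \<bar>empirical_cdf X n x - uniform_cdf x\<bar> \<le> D / real n) \<longrightarrow>
        (\<Sum>i\<in>{1..n}. (f (X n i) - f\<^sub>0 (X n i))\<^sup>2) \<le> E * (real n * \<delta> powr (2 + d / h) + D * \<delta>\<^sup>2))"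
proof -
  let ?p = "moments W"
  define B where "B = R - father_norm W N f\<^sub>0"
  define A where "A = (1 / d + 1 / (2 * h)) * (\<Sum>l\<in>UNIV. \<alpha> $ l)"
  obtain y where y: "mother W y \<noteq> 0"
    by (rule mother_nonzero[OF W(1)])
  obtain C where C: "C > 0" "\<And>x. \<bar>mother W x\<bar> \<le> C"
    by (rule mother_bounded[OF W]) blast
  define \<kappa> where "\<kappa> = B * 2 powr (- A) * \<bar>mother W y\<bar> ^ CARD('d)"
  define E where "E = B\<^sup>2 * C ^ (2 * CARD('d)) * (real (2 * ?p) ^ CARD('d) + 2 powr d)"
  \<comment> \<open>For \<open>t \<ge> T\<close> all levels are admissible, and so fine that the corner wavelet is an interior one.\<close>
  define T where "T = (\<Sum>l\<in>UNIV. real (N l + 2 * ?p) * \<alpha> $ l)"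
  have B: "B > 0" using f\<^sub>0(2) by (simp add: B_def)
  have T: "0 \<le> T" "real (N l + 2 * ?p) * \<alpha> $ l \<le> T" for l
    unfolding T_def using \<alpha>
    by (auto intro!: sum_nonneg mult_nonneg_nonneg less_imp_le[OF \<alpha>] member_le_sum simp del: of_nat_add of_nat_mult)
  show thesis
  proof
    show "\<kappa> > 0" using B y by (simp add: \<kappa>_def)
    show "E > 0" using B C(1) by (auto simp: E_def intro!: mult_pos_pos add_nonneg_pos)
    show "2 powr (- T) > 0" by simp
    fix \<delta> :: real assume \<delta>: "0 < \<delta>" "\<delta> \<le> 2 powr (- T)"
    define t where "t = - log 2 \<delta>"
    define j where "j = balanced_level \<alpha> t"
    define s where "s = (\<Sum>l\<in>UNIV. real (j l))"
    define c where "c = B / besov_weight \<alpha> j"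
    have \<delta>_eq: "\<delta> = 2 powr (- t)"
      using \<delta> by (simp add: t_def)
    have t: "T \<le> t"
      using \<delta>(2) by (simp add: \<delta>_eq)
    with T(1) have "0 \<le> t" by simp
    note s_ge = sum_balanced_level_ge[OF \<alpha> \<open>0 \<le> t\<close>, folded j_def h_def d_def, folded s_def]
    note s_le = sum_balanced_level_le[OF \<alpha> \<open>0 \<le> t\<close>, folded j_def h_def d_def, folded s_def]
    note w_ge = besov_weight_balanced_ge[OF \<alpha> \<open>0 \<le> t\<close>, folded j_def h_def d_def]
    note w_le = besov_weight_balanced_le[OF \<alpha> \<open>0 \<le> t\<close>, folded j_def h_def d_def, folded A_def]
    have j_ge: "N l + 2 * ?p \<le> j l" for l
      unfolding j_def using T(2)[of l] t \<open>0 \<le> t\<close> by (intro balanced_level_ge \<alpha>) auto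
    have j_gt: "2 * ?p < 2 ^ j l" for l
    proof -
      have "2 * ?p \<le> j l" using j_ge[of l] by simp
      also have "j l < 2 ^ j l" by (rule less_exp)
      finally show ?thesis .
    qed
    have pos: "(\<lambda>_. ?p) \<in> positions j"
      by (intro corner_position j_gt)
    have N_le: "N l \<le> j l" for l
      using j_ge[of l] by simp
    have c0: "0 \<le> c" and cw: "besov_weight \<alpha> j * c \<le> R - father_norm W N f\<^sub>0"
      using B besov_weight_pos[of \<alpha> j] by (simp_all add: c_def B_def[symmetric])
    obtain c' where c': "\<bar>c'\<bar> = c"
      and ball: "(\<lambda>x. f\<^sub>0 x + c' * corner_psi W j x) \<in> besov_ball W N \<alpha> R"
      by (rule besov_ball_add_wavelet[OF W f\<^sub>0(1) N_le pos c0 cw])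
    let ?f = "\<lambda>x. f\<^sub>0 x + c' * corner_psi W j x"
    have "\<kappa> * \<delta> = B * 2 powr (- (t * (1 + d / (2 * h)) + A)) * \<bar>mother W y\<bar> ^ CARD('d) * 2 powr ((t * d / h) / 2)"
      unfolding \<kappa>_def \<delta>_eq by (simp add: powr_add[symmetric] algebra_simps)
    also have "\<dots> \<le> c * \<bar>mother W y\<bar> ^ CARD('d) * 2 powr (s / 2)"
    proof (intro mult_mono)
      show "B * 2 powr (- (t * (1 + d / (2 * h)) + A)) \<le> c"
        unfolding c_def powr_minus_divide using w_le B besov_weight_pos[of \<alpha> j]
        by (simp add: divide_left_mono)
    qed (use s_ge c0 in auto)
    also have "\<dots> \<le> sup_dist ?f f\<^sub>0"
      using sup_dist_corner_psi_ge[where j=j and c=c' and f=f\<^sub>0, OF W j_gt y] by (simp add: c' s_def)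
    finally have far: "\<kappa> * \<delta> \<le> sup_dist ?f f\<^sub>0" .
    have c_sq: "c\<^sup>2 \<le> B\<^sup>2 * \<delta> powr (2 + d / h)"
    proof -
      have "c \<le> B * 2 powr (- (t * (1 + d / (2 * h))))"
        unfolding c_def powr_minus_divide using w_ge B besov_weight_pos[of \<alpha> j]
        by (simp add: divide_left_mono)
      then have "c\<^sup>2 \<le> (B * 2 powr (- (t * (1 + d / (2 * h)))))\<^sup>2"
        using c0 by (intro power_mono)
      also have "\<dots> = B\<^sup>2 * \<delta> powr (2 + d / h)"
        by (simp add: \<delta>_eq power_mult_distrib powr_powr powr_power algebra_simps)
      finally show ?thesis .
    qed
    have close: "(\<Sum>i\<in>{1..n}. (?f (X n i) - f\<^sub>0 (X n i))\<^sup>2) \<le> E * (real n * \<delta> powr (2 + d / h) + D * \<delta>\<^sup>2)"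
      if X: "\<forall>i\<in>{1..n}. X n i \<in> unit_cube" "0 < n" and D: "0 \<le> D"
        and disc: "\<forall>x\<in>unit_cube. \<bar>empirical_cdf X n x - uniform_cdf x\<bar> \<le> D / real n"
      for X n D
    proof -
      let ?P = "real (2 * ?p) ^ CARD('d)" and ?C = "C ^ (2 * CARD('d))"
      have *: "\<delta> powr (2 + d / h) * 2 powr s \<le> 2 powr d * \<delta>\<^sup>2"
      proof -
        have "\<delta> powr (2 + d / h) * 2 powr s \<le> \<delta> powr (2 + d / h) * 2 powr (t * d / h + d)"
          using s_le by (intro mult_left_mono powr_mono) auto
        also have "\<dots> = 2 powr d * \<delta>\<^sup>2"
          by (simp add: \<delta>_eq powr_powr powr_power powr_add[symmetric] algebra_simps)
        finally show ?thesis .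
      qed
      have "(\<Sum>i\<in>{1..n}. (?f (X n i) - f\<^sub>0 (X n i))\<^sup>2) = c\<^sup>2 * (\<Sum>i\<in>{1..n}. (corner_psi W j (X n i))\<^sup>2)"
        using c' by (simp add: power_mult_distrib sum_distrib_left power2_abs[of c', symmetric])
      also have "\<dots> \<le> (B\<^sup>2 * \<delta> powr (2 + d / h)) * (?C * (?P * real n + D * 2 powr s))"
        using sum_corner_psi_design_le[where j=j and X=X and n=n and D=D, OF W j_gt C(2)] X disc unfolding s_def
        by (intro mult_mono c_sq) (auto intro!: sum_nonneg)
      also have "\<dots> = B\<^sup>2 * ?C * (?P * (real n * \<delta> powr (2 + d / h)) + D * (\<delta> powr (2 + d / h) * 2 powr s))"
        by (simp add: algebra_simps)
      also have "\<dots> \<le> B\<^sup>2 * ?C * (?P * (real n * \<delta> powr (2 + d / h)) + D * (2 powr d * \<delta>\<^sup>2))"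
        using * D C(1) by (intro mult_left_mono add_left_mono) auto
      also have "\<dots> \<le> B\<^sup>2 * ?C * ((?P + 2 powr d) * (real n * \<delta> powr (2 + d / h) + D * \<delta>\<^sup>2))"
        using D C(1) by (intro mult_left_mono) (auto simp: distrib_left distrib_right)
      finally show ?thesis
        by (simp add: E_def mult.assoc)
    qed
    show "\<exists>f\<in>besov_ball W N \<alpha> R. \<kappa> * \<delta> \<le> sup_dist f f\<^sub>0 \<and>
      (\<forall>X n D. (\<forall>i\<in>{1..n}. X n i \<in> unit_cube) \<and> 0 < n \<and> 0 \<le> D \<and>
          (\<forall>x\<in>unit_cube. \<bar>empirical_cdf X n x - uniform_cdf x\<bar> \<le> D / real n) \<longrightarrow>
        (\<Sum>i\<in>{1..n}. (f (X n i) - f\<^sub>0 (X n i))\<^sup>2) \<le> E * (real n * \<delta> powr (2 + d / h) + D * \<delta>\<^sup>2))"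
      using close by (intro bexI[OF _ ball] conjI far) blast
  qed
qed

section \<open>The rate and the lower bound\<close>

lemma uniform_design_discrepancy:
  fixes X :: "nat \<Rightarrow> nat \<Rightarrow> real ^ 'd::finite"
  assumes "uniform_design X"
  obtains D where "D > 0"
    "\<forall>\<^sub>F n in sequentially. \<forall>x\<in>unit_cube. \<bar>empirical_cdf X n x - uniform_cdf x\<bar> \<le> D / real n"
proof -
  let ?S = "\<lambda>n. SUP x\<in>unit_cube. \<bar>empirical_cdf X n x - uniform_cdf x\<bar>"
  obtain D where D: "D > 0" "\<forall>\<^sub>F n in sequentially. norm (?S n) \<le> D * norm (1 / real n)"
    using assms by (auto simp: uniform_design_def elim: landau_o.bigE)
  have bound: "\<bar>empirical_cdf X n x - uniform_cdf x\<bar> \<le> 2" if "x \<in> unit_cube" for n x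
  proof -
    have "card {i \<in> {1..n}. \<forall>l. X n i $ l \<le> x $ l} \<le> card {1..n}"
      by (intro card_mono) auto
    then have "0 \<le> empirical_cdf X n x" "empirical_cdf X n x \<le> 1"
      by (auto simp: empirical_cdf_def divide_le_eq)
    moreover have "0 \<le> uniform_cdf x" "uniform_cdf x \<le> 1"
      using that by (auto simp: uniform_cdf_def unit_cube_def intro!: prod_nonneg prod_le_1)
    ultimately show ?thesis by linarith
  qed
  have "\<forall>\<^sub>F n in sequentially. \<forall>x\<in>unit_cube. \<bar>empirical_cdf X n x - uniform_cdf x\<bar> \<le> D / real n"
    using D(2)
  proof eventually_elim
    case (elim n)
    show ?case
    proof
      fix x :: "real ^ 'd" assume x: "x \<in> unit_cube"
      have "\<bar>empirical_cdf X n x - uniform_cdf x\<bar> \<le> ?S n"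
        by (rule cSUP_upper[OF x]) (auto intro!: bdd_aboveI2 bound)
      with elim show "\<bar>empirical_cdf X n x - uniform_cdf x\<bar> \<le> D / real n"
        by simp
    qed
  qed
  with D(1) show ?thesis by (rule that)
qed

lemma rate_pos:
  assumes "n \<ge> 2"
  shows "rate \<alpha> n > 0"
  using assms by (simp add: rate_def)

lemma rate_tendsto_0:
  assumes "\<And>l. 0 < (\<alpha> :: real ^ 'd::finite) $ l"
  shows "rate \<alpha> \<longlonglongrightarrow> 0"
proof -
  define e where "e = harmonic_mean \<alpha> / (2 * harmonic_mean \<alpha> + real CARD('d))"
  have "e > 0"
    using harmonic_mean_pos[OF assms] by (auto simp: e_def intro!: divide_pos_pos add_pos_pos)
  then have "(\<lambda>n. (real n / ln (real n)) powr (- e)) \<longlonglongrightarrow> 0"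
    by real_asymp
  then show ?thesis
    by (simp add: rate_def[abs_def] e_def)
qed

text \<open>
  The defining property of the rate: at height \<open>rate \<alpha> n\<close> the bump costs \<open>ln n\<close> at the design points,
  the amount that turns into a power of \<open>n\<close> in the likelihood ratio.
\<close>

lemma rate_powr:
  fixes \<alpha> :: "real ^ 'd::finite"
  assumes "\<And>l. 0 < \<alpha> $ l" "n \<ge> 2"
  shows "real n * rate \<alpha> n powr (2 + real CARD('d) / harmonic_mean \<alpha>) = ln (real n)"
proof -
  let ?h = "harmonic_mean \<alpha>" and ?d = "real CARD('d)"
  have h: "?h > 0" by (rule harmonic_mean_pos[OF assms(1)])
  have "2 * ?h + ?d > 0" using h by (intro add_pos_pos) auto
  moreover have "2 + ?d / ?h = (2 * ?h + ?d) / ?h"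
    using h by (simp add: field_simps)
  ultimately have exponent: "- ?h / (2 * ?h + ?d) * (2 + ?d / ?h) = - 1"
    using h by simp
  have "rate \<alpha> n powr (2 + ?d / ?h) = (real n / ln (real n)) powr (- 1)"
    by (simp only: rate_def powr_powr exponent)
  then show ?thesis
    using assms(2) by (simp add: powr_minus_divide)
qed

theorem proposition5p1:
  fixes W :: cdv and \<eta> :: real and N :: "'d::finite \<Rightarrow> nat"
    and X :: "nat \<Rightarrow> nat \<Rightarrow> real ^ 'd" and \<sigma>\<^sub>0 R M :: real
    and \<alpha> :: "real ^ 'd" and f\<^sub>0 :: "real ^ 'd \<Rightarrow> real"
    and test :: "nat \<Rightarrow> (nat \<Rightarrow> real) \<Rightarrow> real"
  assumes "\<eta> > 0" and wavelets: "\<And>l. cdv_basis \<eta> (N l) W"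
    and design: "uniform_design X" and "\<sigma>\<^sub>0 > 0"
    and "R > 0" and "M > 0"
    and "\<alpha> \<in> smoothness_range \<eta>"
    and "f\<^sub>0 \<in> besov_ball W N \<alpha> R"
    and nondegenerate: "father_norm W N f\<^sub>0 < R"
    and tests: "\<And>n. is_test n (test n)"
    and level: "(\<lambda>n. expect \<sigma>\<^sub>0 X n f\<^sub>0 (test n)) \<longlonglongrightarrow> 0"
  shows "\<exists>Q>0. \<exists>c>0. \<forall>\<^sub>F n in sequentially.
    ereal (c * real n powr (- Q)) \<le>
      (SUP f \<in> {f \<in> besov_ball W N \<alpha> R. sup_dist f f\<^sub>0 > M * rate \<alpha> n}.
        ereal (expect \<sigma>\<^sub>0 X n f (\<lambda>y. 1 - test n y)))"
proof -
  let ?e = "2 + real CARD('d) / harmonic_mean \<alpha>"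
  have \<alpha>: "0 < \<alpha> $ l" for l
    using \<open>\<alpha> \<in> smoothness_range \<eta>\<close> by (auto simp: smoothness_range_def)
  obtain \<kappa> E \<delta>\<^sub>0 where pos: "\<kappa> > 0" "E > 0" "\<delta>\<^sub>0 > 0"
    and bump: "\<And>\<delta>. 0 < \<delta> \<Longrightarrow> \<delta> \<le> \<delta>\<^sub>0 \<Longrightarrow> \<exists>f\<in>besov_ball W N \<alpha> R. \<kappa> * \<delta> \<le> sup_dist f f\<^sub>0 \<and>
      (\<forall>X n D. (\<forall>i\<in>{1..n}. X n i \<in> unit_cube) \<and> 0 < n \<and> 0 \<le> D \<and>
          (\<forall>x\<in>unit_cube. \<bar>empirical_cdf X n x - uniform_cdf x\<bar> \<le> D / real n) \<longrightarrow>
        (\<Sum>i\<in>{1..n}. (f (X n i) - f\<^sub>0 (X n i))\<^sup>2) \<le> E * (real n * \<delta> powr ?e + D * \<delta>\<^sup>2))"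
    by (rule besov_ball_bump[OF wavelets \<open>\<eta> > 0\<close> \<alpha> \<open>f\<^sub>0 \<in> besov_ball W N \<alpha> R\<close> nondegenerate]) blast
  obtain D where D: "D > 0"
    and disc: "\<forall>\<^sub>F n in sequentially. \<forall>x\<in>unit_cube. \<bar>empirical_cdf X n x - uniform_cdf x\<bar> \<le> D / real n"
    by (rule uniform_design_discrepancy[OF design])
  \<comment> \<open>Bumps of height \<open>\<kappa> K\<close> times the rate exceed the separation \<open>M\<close> times the rate; the factor \<open>2\<close> makes this strict.\<close>
  define K where "K = 2 * M / \<kappa>"
  have K: "K > 0"
    using \<open>M > 0\<close> pos by (simp add: K_def)
  define Q where "Q = E * (K powr ?e + D) / \<sigma>\<^sub>0\<^sup>2"
  have "Q > 0"
    using pos D \<open>\<sigma>\<^sub>0 > 0\<close> by (auto simp: Q_def intro!: divide_pos_pos mult_pos_pos add_nonneg_pos)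
  have "(\<lambda>n. K * rate \<alpha> n) \<longlonglongrightarrow> K * 0"
    by (intro tendsto_intros rate_tendsto_0 \<alpha>)
  then have small: "\<forall>\<^sub>F n in sequentially. K * rate \<alpha> n < min \<delta>\<^sub>0 1"
    using pos by (intro order_tendstoD(2)) auto
  have level': "\<forall>\<^sub>F n in sequentially. expect \<sigma>\<^sub>0 X n f\<^sub>0 (test n) < 1 / 4"
    using level by (rule order_tendstoD(2)) simp
  have "\<forall>\<^sub>F n in sequentially. ereal (1 / 2 * real n powr (- Q)) \<le>
      (SUP f \<in> {f \<in> besov_ball W N \<alpha> R. sup_dist f f\<^sub>0 > M * rate \<alpha> n}.
        ereal (expect \<sigma>\<^sub>0 X n f (\<lambda>y. 1 - test n y)))"
    using disc small level' eventually_ge_at_top[of "3 :: nat"]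
  proof eventually_elim
    case (elim n)
    define \<delta> where "\<delta> = K * rate \<alpha> n"
    have r: "rate \<alpha> n > 0"
      using elim(4) by (intro rate_pos) auto
    then have \<delta>: "0 < \<delta>" "\<delta> \<le> \<delta>\<^sub>0" "\<delta> \<le> 1"
      using elim(2) K by (auto simp: \<delta>_def)
    obtain f where f: "f \<in> besov_ball W N \<alpha> R" "\<kappa> * \<delta> \<le> sup_dist f f\<^sub>0"
      "(\<Sum>i\<in>{1..n}. (f (X n i) - f\<^sub>0 (X n i))\<^sup>2) \<le> E * (real n * \<delta> powr ?e + D * \<delta>\<^sup>2)"
      using bump[OF \<delta>(1,2)] elim(1,4) design D
      by (metis (no_types, lifting) uniform_design_def less_imp_le not_numeral_le_zero gr0I)
    have "M * rate \<alpha> n < \<kappa> * \<delta>"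
      using r \<open>M > 0\<close> pos by (simp add: \<delta>_def K_def)
    with f have alt: "f \<in> {f \<in> besov_ball W N \<alpha> R. sup_dist f f\<^sub>0 > M * rate \<alpha> n}"
      by auto
    \<comment> \<open>Absorbs the bounded contribution of the discrepancy into \<open>ln n\<close>; this is where \<open>n \<ge> 3\<close> matters.\<close>
    have ln_n: "1 \<le> ln (real n)"
    proof -
      have "exp 1 \<le> real n" using exp_le elim(4) by linarith
      then show ?thesis using elim(4) by (subst ln_ge_iff) auto
    qed
    have "real n * \<delta> powr ?e = K powr ?e * ln (real n)"
      using rate_powr[OF \<alpha>, of n] elim(4) K r by (simp add: \<delta>_def powr_mult)
    moreover have "D * \<delta>\<^sup>2 \<le> D * ln (real n)"
      using D \<delta> ln_n by (intro mult_left_mono) (auto intro: order_trans[OF power_le_one])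
    ultimately have "E * (real n * \<delta> powr ?e + D * \<delta>\<^sup>2) \<le> E * ((K powr ?e + D) * ln (real n))"
      using pos by (intro mult_left_mono) (auto simp: distrib_right)
    with f(3) have "(\<Sum>i\<in>{1..n}. (f (X n i) - f\<^sub>0 (X n i))\<^sup>2) / \<sigma>\<^sub>0\<^sup>2 \<le> E * ((K powr ?e + D) * ln (real n)) / \<sigma>\<^sub>0\<^sup>2"
      by (intro divide_right_mono) auto
    also have "\<dots> = Q * ln (real n)"
      by (simp add: Q_def)
    finally have a: "real n powr (- Q) \<le> exp (- (\<Sum>i\<in>{1..n}. (f (X n i) - f\<^sub>0 (X n i))\<^sup>2) / \<sigma>\<^sub>0\<^sup>2)"
      using elim(4) by (simp add: powr_def)
    have g [measurable]: "test n \<in> borel_measurable (\<Pi>\<^sub>M i\<in>{1..n}. borel)"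
      and bounds: "\<And>y. y \<in> space (\<Pi>\<^sub>M i\<in>{1..n}. (borel :: real measure)) \<Longrightarrow> 0 \<le> test n y \<and> test n y \<le> 1"
      using tests[of n] by (auto simp: is_test_def)
    have g': "(\<lambda>y. 1 - test n y) \<in> borel_measurable (\<Pi>\<^sub>M i\<in>{1..n}. borel)"
      by (intro borel_measurable_diff g) simp
    have bounds': "0 \<le> 1 - test n y \<and> 1 - test n y \<le> 1"
      if "y \<in> space (\<Pi>\<^sub>M i\<in>{1..n}. (borel :: real measure))" for y
      using bounds[OF that] by simp
    have "expect \<sigma>\<^sub>0 X n f\<^sub>0 (\<lambda>y. 1 - test n y) = 1 - expect \<sigma>\<^sub>0 X n f\<^sub>0 (test n)"
      by (rule expect_complement[OF \<open>\<sigma>\<^sub>0 > 0\<close> g bounds])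
    then have "1 / 2 \<le> 2 * expect \<sigma>\<^sub>0 X n f\<^sub>0 (\<lambda>y. 1 - test n y) - 1"
      using elim(3) by simp
    then have "real n powr (- Q) * (1 / 2) \<le> exp (- (\<Sum>i\<in>{1..n}. (f (X n i) - f\<^sub>0 (X n i))\<^sup>2) / \<sigma>\<^sub>0\<^sup>2) *
        (2 * expect \<sigma>\<^sub>0 X n f\<^sub>0 (\<lambda>y. 1 - test n y) - 1)"
      using a by (intro mult_mono) auto
    also have "\<dots> \<le> expect \<sigma>\<^sub>0 X n f (\<lambda>y. 1 - test n y)"
      by (rule expect_ge_two_point[OF \<open>\<sigma>\<^sub>0 > 0\<close> g' bounds'])
    finally show ?case
      by (intro SUP_upper2[OF alt]) simp
  qed
  then show ?thesis
    using \<open>Q > 0\<close> by (intro exI[of _ Q] exI[of _ "1 / 2"] conjI) auto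
qed

end
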